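(* Let $k,n\ge 2$ and $l\ge 1$ be integers, and let $Y=\mathrm{Gr}(n,k+n)\cap Y_1\cap\dots\cap Y_l$ be a smooth Fano complete intersection of the Grassmannian (in its Plücker embedding) with hypersurfaces $Y_i$ of degrees $d_i\geq 1$, so that $\sum_{i=1}^l d_i<k+n$. Let $f_Y$ be the Laurent polynomial in $nk-l$ variables associated to $(d_1,\dots,d_l)$ by the construction described in the context (the Laurent polynomial representing the superpotential of the Batyrev–Ciocan-Fontanine–Kim–van Straten Landau–Ginzburg model of $Y$). Then $f_Y$ satisfies the period condition for $Y$: $$\sum_{i\ge 0}[f_Y^i]\,t^i=\widetilde{I}^Y_0 ,$$ where $[\,\cdot\,]$ denotes the constant term of a Laurent polynomial. In other words, $f_Y$ is a very weak Landau–Ginzburg model for $Y$.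
   Context: Everything is over $\mathbb{C}$; $[n_1,n_2]=\{i\in\mathbb{Z}\mid n_1\le i\le n_2\}$. A Laurent polynomial is a very weak Landau–Ginzburg model for $Y$ if it satisfies the period condition $\sum_{i\ge0}[f^i]t^i=\widetilde{I}_0^Y$. The series $\widetilde{I}^Y_0$ (constant term of the regularized $I$-series of $Y$, which the paper identifies with Givental's integral $I_Y^0$ of $Y$) is, with $d_0=k+n-\sum_{i=1}^l d_i$, $$\widetilde{I}^Y_0=\sum_{d\ge0}\ \sum_{s_{i,j}\ge0}\frac{\prod_{i=0}^l(d_id)!}{(d!)^{k+n}}\ \prod_{i=1}^{k-1}\prod_{j=1}^{n-1}\binom{s_{i+1,j}}{s_{i,j}}\binom{s_{i,j+1}}{s_{i,j}}\ t^{d_0d},$$ where the inner sum is over non-negative integers $s_{i,j}$, $i\in[1,k-1]$, $j\in[1,n-1]$, and $s_{k,j}=s_{i,n}=d$. Quiver. $\mathcal{Q}$ has vertex set $\{(i,j)\mid i\in[1,k],\, j\in[1,n]\}\cup\{(0,1),(k,n+1)\}$. Its set of arrows $\mathrm{Ar}(\mathcal{Q})$ consists of the vertical arrows $\mathbf{v}_{i,j}\colon(i,j)\to(i+1,j)$ for $i\in[1,k-1]$, $j\in[1,n]$; the horizontal arrows $\mathbf{h}_{i,j}\colon(i,j)\to(i,j+1)$ for $i\in[1,k]$, $j\in[1,n-1]$; and the extra arrows $\mathbf{v}_{0,1}\colon(0,1)\to(1,1)$ (vertical) and $\mathbf{h}_{k,n}\colon(k,n)\to(k,n+1)$ (horizontal).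 For an arrow $\alpha$, $t(\alpha)$ and $h(\alpha)$ denote its tail (source) and head (target). Blocks. $\mathrm{HB}(r,s)$ ($0\le r<s\le k$) is the set of all vertical arrows $\mathbf{v}_{i,j}$ with $i\in[r,s-1]$; $\mathrm{VB}(r,s)$ ($1\le r<s\le n+1$) is the set of all horizontal arrows $\mathbf{h}_{i,j}$ with $j\in[r,s-1]$; $\mathrm{MB}(r,s)=\mathrm{HB}(r,k)\cup\mathrm{VB}(1,s)$. Put $u_0=0$, $u_p=d_1+\dots+d_p$. The consecutive blocks of sizes $d_1,\dots,d_l$ are: $B_p=\mathrm{HB}(u_{p-1},u_p)$ if $u_p\le k$; $B_p=\mathrm{MB}(u_{p-1},u_p-k+1)$ if $u_{p-1}<k<u_p$; $B_p=\mathrm{VB}(u_{p-1}-k+1,u_p-k+1)$ if $u_{p-1}\ge k$. Put $B_0=\mathrm{Ar}(\mathcal{Q})\setminus(B_1\cup\dots\cup B_l)$ (it contains $\mathbf{h}_{k,n}$) and $A=B_0\setminus\{\mathbf{h}_{k,n}\}$. Functions. Let $V=\{a_{i,j}\mid i\in[1,k],\,j\in[1,n],\,(i,j)\ne(k,n)\}\cup\{a\}$ be a set of $nk$ variables, and put $a_{k,n}=1$, $a_{0,1}=a_{k,n+1}=a$. For $C\subset\mathrm{Ar}(\mathcal{Q})$ put $F_C=\sum_{\alpha\in C}a_{h(\alpha)}/a_{t(\alpha)}$. Construction of $f_Y$. The weight variable $x_p$ of the block $B_p$ is: $a_{u_p-1,1}$ if $1<u_p\le k$; $a$ if $u_p=1$;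 $a_{k,u_p-k}$ if $u_p>k$. These are $l$ distinct elements of $V$; let $V'=V\setminus\{x_1,\dots,x_l\}$. For a Laurent polynomial $G$ in the variables $V$ let $\bar G$ be the Laurent polynomial in the variables $V'$ obtained by substituting $x_1=\dots=x_l=1$. Then $$f_Y=\overline{F_A}+\bar a\cdot\prod_{p=1}^l\big(\overline{F_{B_p}}\big)^{d_p}.$$ This is the pull-back of the superpotential $F_{B_0}=F_A+a$ under the birational equivalence between the torus with coordinates $V'$ and the variety $\{F_{B_1}=\dots=F_{B_l}=1\}$ that the paper constructs. *)

theory Defs
  imports
    "HOL-Analysis.Analysis"
    "HOL-Library.Poly_Mapping"
    "HOL-Computational_Algebra.Formal_Power_Series"
    "Graph_Theory.Digraph"
begin

section \<open>Laurent polynomials\<close>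

text \<open>
  Exponents of monomials are finitely supported integer-valued functions on the variables; with the
  convolution product of \<^theory>\<open>HOL-Library.Poly_Mapping\<close>, Laurent polynomials over the complex
  numbers form a commutative ring.
\<close>

type_synonym 'v exponent = "'v \<Rightarrow>\<^sub>0 int"
type_synonym 'v laurent = "'v exponent \<Rightarrow>\<^sub>0 complex"

definition monomial :: "'v exponent \<Rightarrow> 'v laurent" where
  "monomial e = Poly_Mapping.single e 1"

definition constant_term :: "'v laurent \<Rightarrow> complex" where
  "constant_term f = Poly_Mapping.lookup f 0"

definition period_series :: "'v laurent \<Rightarrow> complex fps" where
  "period_series f = Abs_fps (\<lambda>i. constant_term (f ^ i))"

definition drop_vars :: "'v set \<Rightarrow> 'v exponent \<Rightarrow> 'v exponent" where
  "drop_vars X e = (\<Sum>v\<in>Poly_Mapping.keys e - X. Poly_Mapping.single v (Poly_Mapping.lookup e v))"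

text \<open>Substituting 1 for all variables in \<open>X\<close>.\<close>

definition subst_one :: "'v set \<Rightarrow> 'v laurent \<Rightarrow> 'v laurent" where
  "subst_one X f =
     (\<Sum>e\<in>Poly_Mapping.keys f. Poly_Mapping.single (drop_vars X e) (Poly_Mapping.lookup f e))"

definition laurent_in :: "'v set \<Rightarrow> 'v laurent set" where
  "laurent_in W = {f. \<forall>e\<in>Poly_Mapping.keys f. Poly_Mapping.keys e \<subseteq> W}"


section \<open>The quiver and its blocks\<close>

text \<open>
  \<open>Vert i j\<close> is the arrow \<open>(i,j) \<rightarrow> (i+1,j)\<close> and \<open>Horiz i j\<close> the arrow \<open>(i,j) \<rightarrow> (i,j+1)\<close>; this
  covers the two extra arrows \<open>Vert 0 1\<close> and \<open>Horiz k n\<close> as well.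
\<close>

datatype arrow = Vert nat nat | Horiz nat nat

fun arrow_tail :: "arrow \<Rightarrow> nat \<times> nat" where
  "arrow_tail (Vert i j) = (i, j)"
| "arrow_tail (Horiz i j) = (i, j)"

fun arrow_head :: "arrow \<Rightarrow> nat \<times> nat" where
  "arrow_head (Vert i j) = (i + 1, j)"
| "arrow_head (Horiz i j) = (i, j + 1)"

definition quiver :: "nat \<Rightarrow> nat \<Rightarrow> (nat \<times> nat, arrow) pre_digraph" where
  "quiver k n =
     \<lparr>verts = {1..k} \<times> {1..n} \<union> {(0, 1), (k, n + 1)},
      arcs = {Vert i j | i j. i \<in> {1..k - 1} \<and> j \<in> {1..n}}
             \<union> {Horiz i j | i j. i \<in> {1..k} \<and> j \<in> {1..n - 1}}
             \<union> {Vert 0 1, Horiz k n},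
      tail = arrow_tail,
      head = arrow_head\<rparr>"

definition HB :: "nat \<Rightarrow> nat \<Rightarrow> nat \<Rightarrow> nat \<Rightarrow> arrow set" where
  "HB k n r s = {\<alpha> \<in> arcs (quiver k n). \<exists>i j. \<alpha> = Vert i j \<and> r \<le> i \<and> i < s}"

definition VB :: "nat \<Rightarrow> nat \<Rightarrow> nat \<Rightarrow> nat \<Rightarrow> arrow set" where
  "VB k n r s = {\<alpha> \<in> arcs (quiver k n). \<exists>i j. \<alpha> = Horiz i j \<and> r \<le> j \<and> j < s}"

definition MB :: "nat \<Rightarrow> nat \<Rightarrow> nat \<Rightarrow> nat \<Rightarrow> arrow set" where
  "MB k n r s = HB k n r k \<union> VB k n 1 s"

text \<open>The degrees are given by a function \<open>d\<close>, of which only the values on \<open>{1..l}\<close> are used.\<close>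

definition partial_deg :: "(nat \<Rightarrow> nat) \<Rightarrow> nat \<Rightarrow> nat" where
  "partial_deg d p = (\<Sum>i = 1..p. d i)"

text \<open>
  The blocks for \<open>p \<ge> 1\<close>; the truncated subtractions are exact in the branches in which they occur.
\<close>

definition block :: "nat \<Rightarrow> nat \<Rightarrow> (nat \<Rightarrow> nat) \<Rightarrow> nat \<Rightarrow> arrow set" where
  "block k n d p =
     (let u = partial_deg d (p - 1); u' = partial_deg d p in
      if u' \<le> k then HB k n u u'
      else if u < k then MB k n u (u' - k + 1)
      else VB k n (u - k + 1) (u' - k + 1))"

definition block0 :: "nat \<Rightarrow> nat \<Rightarrow> nat \<Rightarrow> (nat \<Rightarrow> nat) \<Rightarrow> arrow set" where
  "block0 k n l d = arcs (quiver k n) - (\<Union>p\<in>{1..l}. block k n d p)"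


section \<open>The Laurent polynomial of the Landau--Ginzburg model\<close>

text \<open>\<open>EntryVar i j\<close> is the variable $a_{i,j}$ and \<open>ExtraVar\<close> is the variable $a$.\<close>

datatype lg_var = EntryVar nat nat | ExtraVar

definition lg_vars :: "nat \<Rightarrow> nat \<Rightarrow> lg_var set" where
  "lg_vars k n =
     {EntryVar i j | i j. i \<in> {1..k} \<and> j \<in> {1..n} \<and> (i, j) \<noteq> (k, n)} \<union> {ExtraVar}"

text \<open>
  The exponent of $a_v$ for a vertex \<open>v\<close>, with the conventions $a_{k,n} = 1$ and
  $a_{0,1} = a_{k,n+1} = a$.
\<close>

definition vertex_exponent :: "nat \<Rightarrow> nat \<Rightarrow> nat \<times> nat \<Rightarrow> lg_var exponent" where
  "vertex_exponent k n v =
     (if v = (k, n) then 0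
      else if v = (0, 1) \<or> v = (k, n + 1) then Poly_Mapping.single ExtraVar 1
      else Poly_Mapping.single (EntryVar (fst v) (snd v)) 1)"

definition F :: "nat \<Rightarrow> nat \<Rightarrow> arrow set \<Rightarrow> lg_var laurent" where
  "F k n C =
     (\<Sum>\<alpha>\<in>C. monomial (vertex_exponent k n (head (quiver k n) \<alpha>)
                       - vertex_exponent k n (tail (quiver k n) \<alpha>)))"

definition weight_var :: "nat \<Rightarrow> (nat \<Rightarrow> nat) \<Rightarrow> nat \<Rightarrow> lg_var" where
  "weight_var k d p =
     (let u = partial_deg d p in
      if u = 1 then ExtraVar
      else if u \<le> k then EntryVar (u - 1) 1
      else EntryVar k (u - k))"

definition weight_vars :: "nat \<Rightarrow> nat \<Rightarrow> (nat \<Rightarrow> nat) \<Rightarrow> lg_var set" where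
  "weight_vars k l d = weight_var k d ` {1..l}"

definition f_LG :: "nat \<Rightarrow> nat \<Rightarrow> nat \<Rightarrow> (nat \<Rightarrow> nat) \<Rightarrow> lg_var laurent" where
  "f_LG k n l d =
     (let bar = subst_one (weight_vars k l d);
          A = block0 k n l d - {Horiz k n}
      in bar (F k n A)
         + bar (monomial (Poly_Mapping.single ExtraVar 1))
           * (\<Prod>p = 1..l. bar (F k n (block k n d p)) ^ d p))"


section \<open>The constant term of the regularized I-series\<close>

text \<open>The degrees extended by $d_0 = k + n - (d_1 + \dots + d_l)$.\<close>

definition ext_deg :: "nat \<Rightarrow> nat \<Rightarrow> nat \<Rightarrow> (nat \<Rightarrow> nat) \<Rightarrow> nat \<Rightarrow> nat" where
  "ext_deg k n l d i = (if i = 0 then k + n - (\<Sum>i = 1..l. d i) else d i)"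

text \<open>A family \<open>s\<close> extended by the boundary values $s_{k,j} = s_{i,n} = m$.\<close>

definition bdry :: "nat \<Rightarrow> nat \<Rightarrow> nat \<Rightarrow> (nat \<times> nat \<Rightarrow> nat) \<Rightarrow> nat \<Rightarrow> nat \<Rightarrow> nat" where
  "bdry k n m s i j = (if i = k \<or> j = n then m else s (i, j))"

text \<open>
  The inner sum ranges over all families of natural numbers; only finitely many of its terms are
  nonzero.
\<close>

definition I0_coeff :: "nat \<Rightarrow> nat \<Rightarrow> nat \<Rightarrow> (nat \<Rightarrow> nat) \<Rightarrow> nat \<Rightarrow> complex" where
  "I0_coeff k n l d m =
     (\<Sum>\<^sub>\<infinity>s\<in>({1..k - 1} \<times> {1..n - 1}) \<rightarrow>\<^sub>E UNIV.
        (\<Prod>i = 0..l. fact (ext_deg k n l d i * m)) / fact m ^ (k + n)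
        * (\<Prod>i = 1..k - 1. \<Prod>j = 1..n - 1.
             of_nat (bdry k n m s (i + 1) j choose bdry k n m s i j)
             * of_nat (bdry k n m s i (j + 1) choose bdry k n m s i j)))"

definition I0_series :: "nat \<Rightarrow> nat \<Rightarrow> nat \<Rightarrow> (nat \<Rightarrow> nat) \<Rightarrow> complex fps" where
  "I0_series k n l d =
     suminf (\<lambda>m. fps_const (I0_coeff k n l d m) * fps_X ^ (ext_deg k n l d 0 * m))"


section \<open>Well-definedness\<close>

lemma fps_X_power_sums:
  fixes c :: "nat \<Rightarrow> 'a :: comm_ring_1"
  assumes "q > 0"
  shows "(\<lambda>m. fps_const (c m) * fps_X ^ (q * m)) sums
           Abs_fps (\<lambda>i. if q dvd i then c (i div q) else 0)"
  unfolding sums_def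
proof (rule tendsto_fpsI)
  fix i
  have "fps_nth (\<Sum>m<N. fps_const (c m) * fps_X ^ (q * m)) i =
        (if q dvd i then c (i div q) else 0)" if "N > i" for N
  proof -
    have "fps_nth (\<Sum>m<N. fps_const (c m) * fps_X ^ (q * m)) i =
          (\<Sum>m<N. if i = q * m then c m else 0)"
      by (simp add: fps_sum_nth if_distrib cong: if_cong)
    also have "\<dots> = (\<Sum>m<N. if q dvd i \<and> m = i div q then c m else 0)"
      using assms by (intro sum.cong) auto
    also have "\<dots> = (if q dvd i then c (i div q) else 0)"
      using le_less_trans[OF div_le_dividend that, of q] by (cases "q dvd i") simp_all
    finally show ?thesis .
  qed
  then show "\<forall>\<^sub>F N in sequentially. fps_nth (\<Sum>m<N. fps_const (c m) * fps_X ^ (q * m)) i =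
               fps_nth (Abs_fps (\<lambda>i. if q dvd i then c (i div q) else 0)) i"
    unfolding fps_nth_Abs_fps by (rule eventually_mono[OF eventually_gt_at_top[of i]])
qed

lemma I0_series_sums:
  assumes "(\<Sum>i = 1..l. d i) < k + n"
  shows "(\<lambda>m. fps_const (I0_coeff k n l d m) * fps_X ^ (ext_deg k n l d 0 * m)) sums I0_series k n l d"
  unfolding I0_series_def
  by (rule summable_sums, rule sums_summable, rule fps_X_power_sums)
     (use assms in \<open>simp add: ext_deg_def\<close>)

lemma subst_one_in:
  assumes "f \<in> laurent_in W"
  shows "subst_one X f \<in> laurent_in (W - X)"
proof -
  have *: "Poly_Mapping.keys (drop_vars X e) \<subseteq> Poly_Mapping.keys e - X" for e :: "'a exponent"
  proof -
    have "Poly_Mapping.keys (drop_vars X e) \<subseteq> (\<Union>v\<in>Poly_Mapping.keys e - X. {v})"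
      unfolding drop_vars_def by (rule order.trans[OF keys_sum]) (auto split: if_splits)
    then show ?thesis by auto
  qed
  have **: "Poly_Mapping.keys (subst_one X f) \<subseteq> drop_vars X ` Poly_Mapping.keys f"
    unfolding subst_one_def by (rule order.trans[OF keys_sum]) (auto split: if_splits)
  show ?thesis
    unfolding laurent_in_def
  proof (intro CollectI ballI)
    fix e assume "e \<in> Poly_Mapping.keys (subst_one X f)"
    then obtain e' where e': "e = drop_vars X e'" "e' \<in> Poly_Mapping.keys f"
      using ** by blast
    then have "Poly_Mapping.keys e' \<subseteq> W"
      using assms by (simp add: laurent_in_def)
    then show "Poly_Mapping.keys e \<subseteq> W - X"
      using *[of e'] by (auto simp: e')
  qed
qed

lemma laurent_in_add: "f \<in> laurent_in W \<Longrightarrow> g \<in> laurent_in W \<Longrightarrow> f + g \<in> laurent_in W"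
  using Poly_Mapping.keys_add[of f g] unfolding laurent_in_def by blast

lemma laurent_in_mult:
  assumes "f \<in> laurent_in W" "g \<in> laurent_in W"
  shows "f * g \<in> laurent_in W"
  unfolding laurent_in_def
proof (intro CollectI ballI)
  fix e assume "e \<in> Poly_Mapping.keys (f * g)"
  then obtain a b where e: "e = a + b" "a \<in> Poly_Mapping.keys f" "b \<in> Poly_Mapping.keys g"
    using keys_mult[of f g] by blast
  have "Poly_Mapping.keys a \<subseteq> W" "Poly_Mapping.keys b \<subseteq> W"
    using e assms by (simp_all add: laurent_in_def)
  then show "Poly_Mapping.keys e \<subseteq> W"
    unfolding e(1) by (rule order.trans[OF Poly_Mapping.keys_add Un_least])
qed

lemma laurent_in_one: "1 \<in> laurent_in W"
  unfolding laurent_in_def by simp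

lemma laurent_in_power: "f \<in> laurent_in W \<Longrightarrow> f ^ m \<in> laurent_in W"
  by (induction m) (auto intro: laurent_in_one laurent_in_mult)

lemma laurent_in_prod: "(\<And>i. i \<in> I \<Longrightarrow> f i \<in> laurent_in W) \<Longrightarrow> prod f I \<in> laurent_in W"
  by (induction I rule: infinite_finite_induct) (auto intro: laurent_in_one laurent_in_mult)

lemma F_in:
  assumes "k \<ge> 1" "n \<ge> 1" "C \<subseteq> arcs (quiver k n)"
  shows "F k n C \<in> laurent_in (lg_vars k n)"
proof -
  have v: "Poly_Mapping.keys (vertex_exponent k n v) \<subseteq> lg_vars k n"
    if "v \<in> verts (quiver k n)" for v
    using that by (auto simp: vertex_exponent_def lg_vars_def quiver_def)
  have ht: "head (quiver k n) \<alpha> \<in> verts (quiver k n)" "tail (quiver k n) \<alpha> \<in> verts (quiver k n)"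
    if "\<alpha> \<in> C" for \<alpha>
    using that assms by (auto simp: quiver_def)
  have "Poly_Mapping.keys (F k n C) \<subseteq>
        (\<lambda>\<alpha>. vertex_exponent k n (head (quiver k n) \<alpha>) - vertex_exponent k n (tail (quiver k n) \<alpha>)) ` C"
    unfolding F_def monomial_def by (rule order.trans[OF keys_sum]) auto
  moreover have "Poly_Mapping.keys (vertex_exponent k n (head (quiver k n) \<alpha>)
                   - vertex_exponent k n (tail (quiver k n) \<alpha>)) \<subseteq> lg_vars k n" if "\<alpha> \<in> C" for \<alpha>
    using order.trans[OF keys_diff Un_least[OF v v]] ht[OF that] by blast
  ultimately show ?thesis
    unfolding laurent_in_def by blast
qed

lemma f_LG_in:
  assumes "k \<ge> 1" "n \<ge> 1"
  shows "f_LG k n l d \<in> laurent_in (lg_vars k n - weight_vars k l d)"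
proof -
  let ?bar = "subst_one (weight_vars k l d)" and ?W = "lg_vars k n - weight_vars k l d"
  have B: "block k n d p \<subseteq> arcs (quiver k n)" for p
    by (simp add: block_def Let_def HB_def VB_def MB_def Collect_mono_iff Un_least subset_iff)
  have A: "block0 k n l d - {Horiz k n} \<subseteq> arcs (quiver k n)"
    unfolding block0_def by blast
  have "monomial (Poly_Mapping.single ExtraVar 1) \<in> laurent_in (lg_vars k n)"
    by (simp add: monomial_def laurent_in_def lg_vars_def)
  then have "?bar (monomial (Poly_Mapping.single ExtraVar 1)) \<in> laurent_in ?W"
    by (rule subst_one_in)
  moreover have "?bar (F k n (block k n d p)) ^ d p \<in> laurent_in ?W" for p
    by (rule laurent_in_power[OF subst_one_in[OF F_in[OF assms B]]])
  then have "(\<Prod>p = 1..l. ?bar (F k n (block k n d p)) ^ d p) \<in> laurent_in ?W"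
    by (rule laurent_in_prod)
  moreover have "?bar (F k n (block0 k n l d - {Horiz k n})) \<in> laurent_in ?W"
    by (rule subst_one_in[OF F_in[OF assms A]])
  ultimately show ?thesis
    unfolding f_LG_def Let_def by (simp add: laurent_in_add laurent_in_mult)
qed

lemma card_remaining_vars:
  assumes "k \<ge> 1" "n \<ge> 1" and pos: "\<And>i. i \<in> {1..l} \<Longrightarrow> d i \<ge> 1"
    and fano: "(\<Sum>i = 1..l. d i) < k + n"
  shows "card (lg_vars k n - weight_vars k l d) = n * k - l"
proof -
  have step: "partial_deg d p < partial_deg d q" if "p < q" "q \<le> l" for p q
    unfolding partial_deg_def
    by (rule sum_strict_mono2[of _ _ q]) (use that pos[of q] in auto)
  have pos_u: "1 \<le> partial_deg d p" and lt: "partial_deg d p < k + n" if "p \<in> {1..l}" for p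
  proof -
    show "1 \<le> partial_deg d p"
      using step[of 0 p] that by (simp add: partial_deg_def)
    have "partial_deg d p \<le> partial_deg d l"
      unfolding partial_deg_def using that by (intro sum_mono2) auto
    then show "partial_deg d p < k + n"
      using fano by (simp add: partial_deg_def)
  qed
  have inj_w: "u = u'" if "1 \<le> u" "1 \<le> u'"
    "(if u = 1 then ExtraVar else if u \<le> k then EntryVar (u - 1) 1 else EntryVar k (u - k)) =
     (if u' = 1 then ExtraVar else if u' \<le> k then EntryVar (u' - 1) 1 else EntryVar k (u' - k))"
    for u u'
    using that assms(1) by (auto split: if_splits)
  have "inj_on (weight_var k d) {1..l}"
  proof (rule inj_onI, rule ccontr)
    fix p q assume pq: "p \<in> {1..l}" "q \<in> {1..l}" "weight_var k d p = weight_var k d q" "p \<noteq> q"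
    have "partial_deg d p = partial_deg d q"
      using pq by (intro inj_w pos_u) (simp_all add: weight_var_def Let_def)
    then show False
      using step[of p q] step[of q p] pq by (cases "p < q") auto
  qed
  then have X: "card (weight_vars k l d) = l"
    unfolding weight_vars_def by (simp add: card_image)
  have sub: "weight_vars k l d \<subseteq> lg_vars k n"
  proof -
    have "weight_var k d p \<in> lg_vars k n" if "p \<in> {1..l}" for p
      using pos_u[OF that] lt[OF that] assms(1,2) by (auto simp: weight_var_def lg_vars_def Let_def)
    then show ?thesis by (auto simp: weight_vars_def)
  qed
  have eq: "lg_vars k n =
        insert ExtraVar ((\<lambda>(i, j). EntryVar i j) ` ({1..k} \<times> {1..n} - {(k, n)}))"
    by (auto simp: lg_vars_def)
  have "inj_on (\<lambda>(i, j). EntryVar i j) ({1..k} \<times> {1..n} - {(k, n)})"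
    by (auto simp: inj_on_def)
  then have "card ((\<lambda>(i, j). EntryVar i j) ` ({1..k} \<times> {1..n} - {(k, n)})) = k * n - 1"
    using assms(1,2) by (simp add: card_image card_Diff_subset)
  moreover have "ExtraVar \<notin> (\<lambda>(i, j). EntryVar i j) ` ({1..k} \<times> {1..n} - {(k, n)})"
    by auto
  ultimately have "card (lg_vars k n) = n * k"
    unfolding eq using assms(1,2) by (subst card_insert_disjoint) (auto simp: mult.commute)
  then show ?thesis
    using X sub finite_subset[OF sub] by (simp add: card_Diff_subset eq weight_vars_def)
qed

end

theory Submission
  imports Defs
begin

text \<open>
  The product form of \<^term>\<open>f_LG k n l d\<close> turns its constant terms into a count of integral flows on
  the quiver.

  Since \<open>a = a\<^bsub>k,n+1\<^esub> / a\<^bsub>k,n\<^esub>\<close> is itself the monomial of the last arrow, the binomial and multinomial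
  theorems write the constant term of \<open>f\<^sup>N\<close> as a sum over \<open>m\<close> and over all ways \<open>c\<close> of choosing arrows with
  multiplicity: \<open>m\<close> times the last arrow, \<open>d\<^sub>p m\<close> arrows from the block \<open>B\<^sub>p\<close>, \<open>N - m\<close> arrows from \<open>A\<close>.
  The exponent of a variable \<open>a\<^sub>v\<close> in the chosen product is inflow minus outflow of \<open>c\<close> at the
  vertex \<open>v\<close>, the arrow into \<open>(k,n+1)\<close> and the arrow out of \<open>(0,1)\<close> being balanced against each other.
  So, but for the substitution \<open>x\<^sub>p = 1\<close>, the contributing choices are exactly the flows of value \<open>m\<close>.

  Setting the weight variables to 1 forgets the balance at the vertices of the \<open>x\<^sub>p\<close>, and the first
  point is that nothing is lost. The rows of vertical arrows followed by the columns of horizontal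
  arrows form \<open>k + n\<close> layers; each block is an interval of layers. Each weight variable sits on the path
  down the first column and along the last row, the \<open>p\<close>-th one directly upstream of the last layer of
  \<open>B\<^sub>p\<close>. An imbalance there changes the total flow through all later layers, so the
  prescribed block totals \<open>d\<^sub>p m\<close> force the imbalances to vanish one after the other
  (\<open>net_flow_weight_var\<close>). Conversely a flow of value \<open>m\<close> passes \<open>m\<close> units through every layer
  (\<open>layer_sum_flow\<close>), so it has the right block totals, and the total over \<open>A\<close> forces \<open>N = d\<^sub>0 m\<close>
  (\<open>balanced_choices_eq_flows\<close>). The coefficient of \<open>f\<^sup>N\<close> with \<open>N = d\<^sub>0 m\<close> therefore is
  \<open>\<Prod>\<^sub>i (d\<^sub>i m)!\<close> times the sum of \<open>\<Prod>\<^sub>\<alpha> 1 / c\<^sub>\<alpha>!\<close> over all flows \<open>c\<close> of value \<open>m\<close>.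

  The second point identifies this sum. The quiver is planar, so a flow is the difference of a
  potential on its faces, and the potentials are precisely the families \<open>s\<close> (read with
  the rows in reverse order) that increase weakly in both directions (\<open>flows_bij_patterns\<close>). In each
  layer the increments of \<open>s\<close> add up to \<open>m\<close>, so that \<open>m!\<close> divided by the factorials of the flow is a
  product of binomial coefficients of consecutive values of \<open>s\<close>; altogether these are the binomials of
  \<^term>\<open>I0_coeff k n l d m\<close> (\<open>flow_weight_times_pattern_weight\<close>), whose terms vanish for all other \<open>s\<close>.
\<close>

section \<open>Powers of sums of monomials\<close>

definition compositions :: "'a set \<Rightarrow> nat \<Rightarrow> ('a \<Rightarrow> nat) set" where
  "compositions C N = {c. (\<forall>x. x \<notin> C \<longrightarrow> c x = 0) \<and> sum c C = N}"

lemma finite_bounded_support: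
  fixes S :: "('a \<Rightarrow> nat) set"
  assumes "finite C" "\<And>c x. c \<in> S \<Longrightarrow> x \<notin> C \<Longrightarrow> c x = 0" "\<And>c x. c \<in> S \<Longrightarrow> x \<in> C \<Longrightarrow> c x \<le> N"
  shows "finite S"
proof (rule finite_subset)
  show "S \<subseteq> {c. \<forall>x. (x \<in> C \<longrightarrow> c x \<in> {..N}) \<and> (x \<notin> C \<longrightarrow> c x = 0)}"
    using assms by auto
  show "finite {c. \<forall>x. (x \<in> C \<longrightarrow> c x \<in> {..N}) \<and> (x \<notin> C \<longrightarrow> c x = 0)}"
    by (rule finite_set_of_finite_funs) (use assms in auto)
qed

lemma finite_compositions: "finite C \<Longrightarrow> finite (compositions C N)"
  by (rule finite_bounded_support[of C _ N])
     (auto simp: compositions_def intro: member_le_sum)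

lemma single_power:
  "Poly_Mapping.single e (1 :: 'b :: comm_semiring_1) ^ i =
     Poly_Mapping.single (\<Sum>_<i. e :: 'e :: comm_monoid_add) 1"
  by (induction i) (simp_all add: mult_single lessThan_Suc)

text \<open>
  The multinomial theorem. Exponents live in an additive monoid without scalar multiplication, so
  the \<open>c \<alpha>\<close>-fold multiple of \<open>w \<alpha>\<close> appears as a constant sum. Peeling off one monomial and applying
  the binomial theorem gives the induction step.
\<close>

lemma power_sum_of_monomials:
  fixes w :: "'a \<Rightarrow> 'e :: comm_monoid_add"
  assumes "finite C"
  shows "(\<Sum>\<alpha>\<in>C. Poly_Mapping.single (w \<alpha>) (1 :: 'b :: field_char_0)) ^ N =
    (\<Sum>c\<in>compositions C N.
       Poly_Mapping.single (\<Sum>\<alpha>\<in>C. \<Sum>_<c \<alpha>. w \<alpha>) (fact N / (\<Prod>\<alpha>\<in>C. fact (c \<alpha>))))"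
  using assms
proof (induction C arbitrary: N)
  case empty
  have "compositions {} N = (if N = 0 then {\<lambda>_::'a. 0} else {})"
    by (auto simp: compositions_def)
  then show ?case by (auto simp: power_0_left)
next
  case (insert a C)
  let ?S = "\<Sum>\<alpha>\<in>C. Poly_Mapping.single (w \<alpha>) (1 :: 'b)"
  let ?t = "\<lambda>c. Poly_Mapping.single (\<Sum>\<alpha>\<in>insert a C. \<Sum>_<c \<alpha>. w \<alpha>)
              (fact N / (\<Prod>\<alpha>\<in>insert a C. fact (c \<alpha>)) :: 'b)"
  have "(\<Sum>\<alpha>\<in>insert a C. Poly_Mapping.single (w \<alpha>) (1 :: 'b)) ^ N =
        (Poly_Mapping.single (w a) 1 + ?S) ^ N"
    using insert by simp
  also have "\<dots> = (\<Sum>i\<le>N. of_nat (N choose i) * Poly_Mapping.single (w a) 1 ^ i * ?S ^ (N - i))"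
    by (rule binomial_ring)
  also have "\<dots> = (\<Sum>i\<le>N. \<Sum>c\<in>compositions C (N - i). ?t (c(a := i)))"
  proof (rule sum.cong[OF refl])
    fix i assume "i \<in> {..N}"
    then have i: "i \<le> N" by simp
    have "of_nat (N choose i) * Poly_Mapping.single (w a) 1 ^ i *
          Poly_Mapping.single (\<Sum>\<alpha>\<in>C. \<Sum>_<c \<alpha>. w \<alpha>) (fact (N - i) / (\<Prod>\<alpha>\<in>C. fact (c \<alpha>)) :: 'b)
          = ?t (c(a := i))" for c
    proof -
      have e: "(\<Sum>\<alpha>\<in>C. \<Sum>_<(if \<alpha> = a then i else c \<alpha>). w \<alpha>) = (\<Sum>\<alpha>\<in>C. \<Sum>_<c \<alpha>. w \<alpha>)"
              "(\<Prod>\<alpha>\<in>C. fact (if \<alpha> = a then i else c \<alpha>) :: 'b) = (\<Prod>\<alpha>\<in>C. fact (c \<alpha>))"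
        using insert.hyps by (auto intro!: sum.cong prod.cong)
      show ?thesis
        using insert.hyps i
        by (simp add: e single_power mult_single binomial_fact flip: single_of_nat)
    qed
    then show "of_nat (N choose i) * Poly_Mapping.single (w a) 1 ^ i * ?S ^ (N - i) =
               (\<Sum>c\<in>compositions C (N - i). ?t (c(a := i)))"
      by (simp add: insert.IH sum_distrib_left)
  qed
  also have "\<dots> = (\<Sum>(i, c)\<in>(SIGMA i:{..N}. compositions C (N - i)). ?t (c(a := i)))"
    using insert.hyps by (subst sum.Sigma) (auto simp: finite_compositions)
  also have "\<dots> = (\<Sum>c\<in>compositions (insert a C) N. ?t c)"
  proof (rule sum.reindex_bij_witness[where i = "\<lambda>c. (c a, c(a := 0))"
          and j = "\<lambda>(i, c). c(a := i)"])
    have s: "sum (c(a := i)) C = sum c C" for c :: "'a \<Rightarrow> nat" and i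
      using insert.hyps by (intro sum.cong) auto
    fix x assume "x \<in> (SIGMA i:{..N}. compositions C (N - i))"
    then show "(\<lambda>c. (c a, c(a := 0))) ((\<lambda>(i, c). c(a := i)) x) = x"
      "(\<lambda>(i, c). c(a := i)) x \<in> compositions (insert a C) N"
      using insert.hyps s by (auto simp: compositions_def simp del: fun_upd_apply) (auto simp: fun_eq_iff)
  next
    have s: "sum (c(a := i)) C = sum c C" for c :: "'a \<Rightarrow> nat" and i
      using insert.hyps by (intro sum.cong) auto
    fix c assume "c \<in> compositions (insert a C) N"
    then show "(c a, c(a := 0)) \<in> (SIGMA i:{..N}. compositions C (N - i))"
      using insert.hyps s[of c 0] by (auto simp: compositions_def)
  qed auto
  finally show ?case .
qed

definition multi_compositions :: "'q set \<Rightarrow> ('q \<Rightarrow> 'a set) \<Rightarrow> ('q \<Rightarrow> nat) \<Rightarrow> ('a \<Rightarrow> nat) set" where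
  "multi_compositions I P e =
     {c. (\<forall>x. x \<notin> (\<Union>q\<in>I. P q) \<longrightarrow> c x = 0) \<and> (\<forall>q\<in>I. sum c (P q) = e q)}"

lemma finite_multi_compositions:
  assumes "finite I" "\<And>q. q \<in> I \<Longrightarrow> finite (P q)"
  shows "finite (multi_compositions I P e)"
proof (rule finite_bounded_support[of "\<Union>q\<in>I. P q" _ "sum e I"])
  fix c x assume c: "c \<in> multi_compositions I P e" and "x \<in> (\<Union>q\<in>I. P q)"
  then obtain q where q: "q \<in> I" "x \<in> P q" by auto
  then have "c x \<le> e q"
    using c assms(2)[OF q(1)] member_le_sum[of x "P q" c] by (auto simp: multi_compositions_def)
  also have "\<dots> \<le> sum e I" using q assms by (intro member_le_sum) auto
  finally show "c x \<le> sum e I" .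
qed (use assms in \<open>auto simp: multi_compositions_def\<close>)

text \<open>
  Choices within disjoint parts are independent. A function supported on the union of the parts
  is the pointwise sum of its restrictions, which makes the factors of a product of
  multinomial expansions recombine.
\<close>

lemma prod_power_sum_of_monomials:
  fixes w :: "'a \<Rightarrow> 'e :: comm_monoid_add"
  assumes "finite I" "\<And>q. q \<in> I \<Longrightarrow> finite (P q)" "disjoint_family_on P I"
  shows "(\<Prod>q\<in>I. (\<Sum>\<alpha>\<in>P q. Poly_Mapping.single (w \<alpha>) (1 :: 'b :: field_char_0)) ^ e q) =
    (\<Sum>c\<in>multi_compositions I P e.
       Poly_Mapping.single (\<Sum>\<alpha>\<in>(\<Union>q\<in>I. P q). \<Sum>_<c \<alpha>. w \<alpha>)
         ((\<Prod>q\<in>I. fact (e q)) / (\<Prod>\<alpha>\<in>(\<Union>q\<in>I. P q). fact (c \<alpha>))))"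
  using assms
proof (induction I)
  case empty
  have "multi_compositions {} P e = {\<lambda>_. 0}" by (auto simp: multi_compositions_def)
  then show ?case by simp
next
  case (insert a I)
  define U where "U = (\<Union>q\<in>I. P q)"
  have U: "finite U" "finite (P a)" "P a \<inter> U = {}"
    using insert.prems insert.hyps by (auto simp: U_def disjoint_family_on_def)
  let ?M = "multi_compositions I P e" and ?C = "compositions (P a) (e a)"
  let ?t = "\<lambda>V N c. Poly_Mapping.single (\<Sum>\<alpha>\<in>V. \<Sum>_<c \<alpha>. w \<alpha>) (N / (\<Prod>\<alpha>\<in>V. fact (c \<alpha>)) :: 'b)"
  let ?N = "\<Prod>q\<in>I. fact (e q) :: 'b"
  let ?N' = "\<Prod>q\<in>insert a I. fact (e q) :: 'b"
  have IH: "(\<Prod>q\<in>I. (\<Sum>\<alpha>\<in>P q. Poly_Mapping.single (w \<alpha>) (1 :: 'b)) ^ e q) = (\<Sum>c\<in>?M. ?t U ?N c)"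
    unfolding U_def using insert by (auto simp: disjoint_family_on_def)
  have "(\<Prod>q\<in>insert a I. (\<Sum>\<alpha>\<in>P q. Poly_Mapping.single (w \<alpha>) (1 :: 'b)) ^ e q) =
        (\<Sum>c\<in>?C. ?t (P a) (fact (e a)) c) * (\<Sum>c\<in>?M. ?t U ?N c)"
    using insert.hyps U(2) by (simp add: IH power_sum_of_monomials)
  also have "\<dots> = (\<Sum>(c, c')\<in>?C \<times> ?M. ?t (P a) (fact (e a)) c * ?t U ?N c')"
    by (simp add: sum_product sum.cartesian_product)
  also have "\<dots> = (\<Sum>c\<in>multi_compositions (insert a I) P e. ?t (P a \<union> U) ?N' c)"
  proof (rule sum.reindex_bij_witness[where j = "\<lambda>(c, c') x. c x + c' x"
          and i = "\<lambda>c. (\<lambda>x. if x \<in> P a then c x else 0, \<lambda>x. if x \<in> P a then 0 else c x)"])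
    have off: "x \<notin> P q" if "q \<in> I" "x \<in> P a" for q x
      using U(3) that by (auto simp: U_def)
    fix y assume "y \<in> ?C \<times> ?M"
    then obtain c c' where y: "y = (c, c')" "c \<in> ?C" "c' \<in> ?M" by auto
    have c: "c x = 0" if "x \<notin> P a" for x using y that by (auto simp: compositions_def)
    have c': "c' x = 0" if "x \<notin> U" for x using y that by (auto simp: multi_compositions_def U_def)
    have c'a: "c' x = 0" if "x \<in> P a" for x using c' that U(3) by auto
    show "(\<lambda>c. (\<lambda>x. if x \<in> P a then c x else 0, \<lambda>x. if x \<in> P a then 0 else c x))
            ((\<lambda>(c, c') x. c x + c' x) y) = y"
      using c c'a by (auto simp: y(1) fun_eq_iff)
    have 1: "sum (\<lambda>x. c x + c' x) (P a) = sum c (P a)"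
      using c'a by (intro sum.cong) auto
    have 2: "sum (\<lambda>x. c x + c' x) (P q) = sum c' (P q)" if "q \<in> I" for q
      using c off[OF that] by (intro sum.cong) auto
    show "(\<lambda>(c, c') x. c x + c' x) y \<in> multi_compositions (insert a I) P e"
      using y 1 2 c c' by (auto simp: multi_compositions_def compositions_def U_def)
    have A: "(\<Sum>\<alpha>\<in>P a. \<Sum>_<c \<alpha> + c' \<alpha>. w \<alpha>) = (\<Sum>\<alpha>\<in>P a. \<Sum>_<c \<alpha>. w \<alpha>)"
       "(\<Prod>\<alpha>\<in>P a. fact (c \<alpha> + c' \<alpha>) :: 'b) = (\<Prod>\<alpha>\<in>P a. fact (c \<alpha>))"
      using c'a by (auto intro!: sum.cong prod.cong)
    have cU: "c x = 0" if "x \<in> U" for x using c that U(3) by auto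
    have B: "(\<Sum>\<alpha>\<in>U. \<Sum>_<c \<alpha> + c' \<alpha>. w \<alpha>) = (\<Sum>\<alpha>\<in>U. \<Sum>_<c' \<alpha>. w \<alpha>)"
       "(\<Prod>\<alpha>\<in>U. fact (c \<alpha> + c' \<alpha>) :: 'b) = (\<Prod>\<alpha>\<in>U. fact (c' \<alpha>))"
      using cU by (auto intro!: sum.cong prod.cong)
    show "?t (P a \<union> U) ?N' ((\<lambda>(c, c') x. c x + c' x) y) =
          (case y of (c, c') \<Rightarrow> ?t (P a) (fact (e a)) c * ?t U ?N c')"
      using U insert.hyps by (simp add: y(1) mult_single sum.union_disjoint prod.union_disjoint A B)
  next
    fix c assume "c \<in> multi_compositions (insert a I) P e"
    then have c: "\<And>x. x \<notin> P a \<union> U \<Longrightarrow> c x = 0"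
      and s: "\<And>q. q \<in> insert a I \<Longrightarrow> sum c (P q) = e q"
      by (auto simp: multi_compositions_def U_def)
    have off: "x \<notin> P a" if "q \<in> I" "x \<in> P q" for q x
      using U(3) that by (auto simp: U_def)
    have 1: "sum (\<lambda>x. if x \<in> P a then 0 else c x) (P q) = e q" if "q \<in> I" for q
      using s[of q] off[OF that] that by (auto intro!: sum.cong)
    show "(\<lambda>x. if x \<in> P a then c x else 0, \<lambda>x. if x \<in> P a then 0 else c x) \<in> ?C \<times> ?M"
      using c s[of a] 1 by (auto simp: multi_compositions_def compositions_def U_def)
  qed auto
  finally show ?case by (simp add: U_def)
qed

text \<open>
  Only choices of monomials whose total exponent is zero contribute to the constant term; stated per
  variable, this becomes the balance condition of a flow.
\<close>

lemma constant_term_prod_power: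
  fixes w :: "'a \<Rightarrow> 'v exponent"
  assumes "finite I" "\<And>q. q \<in> I \<Longrightarrow> finite (P q)" "disjoint_family_on P I"
  shows "constant_term (\<Prod>q\<in>I. (\<Sum>\<alpha>\<in>P q. monomial (w \<alpha>)) ^ e q) =
    (\<Sum>c | c \<in> multi_compositions I P e \<and>
          (\<forall>v. (\<Sum>\<alpha>\<in>(\<Union>q\<in>I. P q). int (c \<alpha>) * Poly_Mapping.lookup (w \<alpha>) v) = 0).
       (\<Prod>q\<in>I. fact (e q)) / (\<Prod>\<alpha>\<in>(\<Union>q\<in>I. P q). fact (c \<alpha>)))"
proof -
  have z: "(\<Sum>\<alpha>\<in>U. \<Sum>_<c \<alpha>. w \<alpha>) = 0 \<longleftrightarrow>
           (\<forall>v. (\<Sum>\<alpha>\<in>U. int (c \<alpha>) * Poly_Mapping.lookup (w \<alpha>) v) = 0)" for U and c :: "'a \<Rightarrow> nat"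
    by (simp add: poly_mapping_eq_iff fun_eq_iff lookup_sum)
  have "constant_term (\<Prod>q\<in>I. (\<Sum>\<alpha>\<in>P q. monomial (w \<alpha>)) ^ e q) =
    (\<Sum>c\<in>multi_compositions I P e. if (\<Sum>\<alpha>\<in>(\<Union>q\<in>I. P q). \<Sum>_<c \<alpha>. w \<alpha>) = 0 then
       (\<Prod>q\<in>I. fact (e q)) / (\<Prod>\<alpha>\<in>(\<Union>q\<in>I. P q). fact (c \<alpha>)) else 0)"
    unfolding constant_term_def monomial_def
    by (subst prod_power_sum_of_monomials[OF assms])
       (auto simp: lookup_sum lookup_single when_def)
  then show ?thesis
    using finite_multi_compositions[OF assms(1,2)] by (simp add: z sum.inter_filter)
qed

section \<open>Substitution of 1 is additive\<close>

lemma lookup_drop_vars: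
  "Poly_Mapping.lookup (drop_vars X e) v = (if v \<in> X then 0 else Poly_Mapping.lookup e v)"
  by (auto simp: drop_vars_def lookup_sum lookup_single when_def in_keys_iff)

lemma subst_one_monomial: "subst_one X (monomial e) = monomial (drop_vars X e)"
  by (simp add: subst_one_def monomial_def)

text \<open>
  The support of a sum can be smaller than the union of the supports, so additivity
  compares both sides on a common finite superset.
\<close>

lemma subst_one_superset:
  assumes "finite S" "Poly_Mapping.keys f \<subseteq> S"
  shows "subst_one X f = (\<Sum>e\<in>S. Poly_Mapping.single (drop_vars X e) (Poly_Mapping.lookup f e))"
  unfolding subst_one_def by (rule sum.mono_neutral_left) (use assms in \<open>auto simp: in_keys_iff\<close>)

lemma subst_one_add: "subst_one X (f + g) = subst_one X f + subst_one X g"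
proof -
  let ?S = "Poly_Mapping.keys f \<union> Poly_Mapping.keys g"
  have "Poly_Mapping.keys (f + g) \<subseteq> ?S" by (rule Poly_Mapping.keys_add)
  then show ?thesis
    by (simp add: subst_one_superset[of ?S] lookup_add single_add sum.distrib)
qed

lemma subst_one_sum: "subst_one X (\<Sum>x\<in>C. f x) = (\<Sum>x\<in>C. subst_one X (f x))"
proof -
  have "subst_one X 0 = 0" by (simp add: subst_one_def)
  then show ?thesis
    by (induction C rule: infinite_finite_induct) (simp_all add: subst_one_add)
qed

section \<open>Layers of the quiver\<close>

lemma Vert_in_arcs:
  "Vert i j \<in> arcs (quiver k n) \<longleftrightarrow> 1 \<le> i \<and> i < k \<and> 1 \<le> j \<and> j \<le> n \<or> i = 0 \<and> j = 1"
  by (auto simp: quiver_def)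

lemma Horiz_in_arcs:
  "Horiz i j \<in> arcs (quiver k n) \<longleftrightarrow> 1 \<le> i \<and> i \<le> k \<and> 1 \<le> j \<and> j < n \<or> i = k \<and> j = n"
  by (auto simp: quiver_def)

lemma arcs_quiver_eq:
  "arcs (quiver k n) = {Vert 0 1, Horiz k n} \<union>
     ((\<lambda>(i, j). Vert i j) ` ({1..k - 1} \<times> {1..n}) \<union> (\<lambda>(j, i). Horiz i j) ` ({1..n - 1} \<times> {1..k}))"
  by (auto simp: quiver_def)

lemma finite_arcs: "finite (arcs (quiver k n))"
  by (simp add: arcs_quiver_eq)

lemma prod_arcs:
  assumes "1 \<le> k" "1 \<le> n"
  shows "prod g (arcs (quiver k n)) = g (Vert 0 1) * g (Horiz k n) *
           ((\<Prod>i = 1..k - 1. \<Prod>j = 1..n. g (Vert i j)) * (\<Prod>j = 1..n - 1. \<Prod>i = 1..k. g (Horiz i j)))"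
proof -
  have "inj_on (\<lambda>(i, j). Vert i j) A" "inj_on (\<lambda>(j, i). Horiz i j) A" for A
    by (auto simp: inj_on_def)
  then show ?thesis
    unfolding arcs_quiver_eq using assms
    apply (subst prod.union_disjoint)
       apply auto [3]
    apply (subst prod.union_disjoint)
       apply auto [3]
    apply (simp add: prod.reindex prod.cartesian_product case_prod_unfold)
    done
qed

text \<open>
  Rows of vertical arrows come first, columns of horizontal arrows after them: removing
  all arrows of one layer separates \<open>(0,1)\<close> from \<open>(k,n+1)\<close>. The three kinds of blocks
  become the three ways in which an interval of layers can lie with respect to \<open>k\<close>.
\<close>

fun layer :: "nat \<Rightarrow> arrow \<Rightarrow> nat" where
  "layer k (Vert i j) = i"
| "layer k (Horiz i j) = k + j - 1"

lemma block_layer: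
  assumes "1 \<le> k" "1 \<le> n" "p \<in> {1..l}" and fano: "(\<Sum>i = 1..l. d i) < k + n"
  shows "block k n d p =
    {\<alpha> \<in> arcs (quiver k n). partial_deg d (p - 1) \<le> layer k \<alpha> \<and> layer k \<alpha> < partial_deg d p}"
proof (rule set_eqI)
  fix \<alpha>
  let ?u = "partial_deg d (p - 1)" and ?v = "partial_deg d p"
  have "?v \<le> partial_deg d l"
    using assms(3) unfolding partial_deg_def by (intro sum_mono2) auto
  then have "?v < k + n"
    using fano by (simp add: partial_deg_def)
  then show "\<alpha> \<in> block k n d p \<longleftrightarrow> \<alpha> \<in> {\<alpha> \<in> arcs (quiver k n). ?u \<le> layer k \<alpha> \<and> layer k \<alpha> < ?v}"
    using assms(1,2)
    by (cases \<alpha>) (auto simp: block_def Let_def HB_def VB_def MB_def Vert_in_arcs Horiz_in_arcs)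
qed

section \<open>Exponents of variables as net flows\<close>

text \<open>
  Inflow minus outflow. At the borders of the grid the indices \<open>i - 1 = 0\<close> and \<open>j - 1 = 0\<close> lead
  to arrows outside the quiver, where the functions of interest vanish, except for \<open>Vert 0 1\<close>, which
  does enter \<open>(1,1)\<close>. Since \<open>(0,1)\<close> and \<open>(k,n+1)\<close> carry the same variable \<open>a\<close>, they count as a single
  vertex.
\<close>

definition net_flow :: "nat \<Rightarrow> nat \<Rightarrow> (arrow \<Rightarrow> nat) \<Rightarrow> lg_var \<Rightarrow> int" where
  "net_flow k n c v = (case v of
     EntryVar i j \<Rightarrow> int (c (Vert (i - 1) j)) + int (c (Horiz i (j - 1)))
                     - int (c (Vert i j)) - int (c (Horiz i j))
   | ExtraVar \<Rightarrow> int (c (Horiz k n)) - int (c (Vert 0 1)))"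

definition on_quiver :: "nat \<Rightarrow> nat \<Rightarrow> (arrow \<Rightarrow> nat) \<Rightarrow> bool" where
  "on_quiver k n c \<longleftrightarrow> (\<forall>\<alpha>. \<alpha> \<notin> arcs (quiver k n) \<longrightarrow> c \<alpha> = 0)"

definition arrow_exponent :: "nat \<Rightarrow> nat \<Rightarrow> arrow \<Rightarrow> lg_var exponent" where
  "arrow_exponent k n \<alpha> = vertex_exponent k n (arrow_head \<alpha>) - vertex_exponent k n (arrow_tail \<alpha>)"

lemma sum_arcs_eq:
  assumes "on_quiver k n c" "finite S" "\<And>\<alpha>. \<alpha> \<in> arcs (quiver k n) \<Longrightarrow> P \<alpha> \<longleftrightarrow> \<alpha> \<in> S"
  shows "(\<Sum>\<alpha>\<in>arcs (quiver k n). int (c \<alpha>) * of_bool (P \<alpha>)) = (\<Sum>\<alpha>\<in>S. int (c \<alpha>))"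
  by (rule sum.mono_neutral_cong) (use assms in \<open>auto simp: finite_arcs on_quiver_def\<close>)

text \<open>
  An arrow contributes \<open>+1\<close> at its head and \<open>-1\<close> at its tail, except at \<open>(k,n)\<close>, whose variable is 1.
\<close>

lemma lookup_arrow_exponents:
  assumes kn: "1 \<le> k" "1 \<le> n" and c: "on_quiver k n c" and v: "v \<in> lg_vars k n"
  shows "(\<Sum>\<alpha>\<in>arcs (quiver k n). int (c \<alpha>) * Poly_Mapping.lookup (arrow_exponent k n \<alpha>) v) =
         net_flow k n c v"
proof (cases v)
  case (EntryVar i j)
  then have ij: "1 \<le> i" "i \<le> k" "1 \<le> j" "j \<le> n" "(i, j) \<noteq> (k, n)"
    using v by (auto simp: lg_vars_def)
  have lk: "Poly_Mapping.lookup (vertex_exponent k n w) v = of_bool (w = (i, j))" for w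
    using ij by (auto simp: vertex_exponent_def EntryVar lookup_single when_def)
  have "(\<Sum>\<alpha>\<in>arcs (quiver k n). int (c \<alpha>) * of_bool (arrow_head \<alpha> = (i, j))) =
        (\<Sum>\<alpha>\<in>{Vert (i - 1) j, Horiz i (j - 1)}. int (c \<alpha>))"
  proof (rule sum_arcs_eq[OF c])
    fix \<alpha> show "arrow_head \<alpha> = (i, j) \<longleftrightarrow> \<alpha> \<in> {Vert (i - 1) j, Horiz i (j - 1)}"
      using ij by (cases \<alpha>) auto
  qed simp
  moreover have "(\<Sum>\<alpha>\<in>arcs (quiver k n). int (c \<alpha>) * of_bool (arrow_tail \<alpha> = (i, j))) =
        (\<Sum>\<alpha>\<in>{Vert i j, Horiz i j}. int (c \<alpha>))"
  proof (rule sum_arcs_eq[OF c])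
    fix \<alpha> show "arrow_tail \<alpha> = (i, j) \<longleftrightarrow> \<alpha> \<in> {Vert i j, Horiz i j}"
      using ij by (cases \<alpha>) auto
  qed simp
  moreover note lk' = lk[unfolded EntryVar]
  ultimately show ?thesis
    by (simp add: arrow_exponent_def lookup_minus lk' right_diff_distrib sum_subtractf EntryVar net_flow_def)
next
  case ExtraVar
  have lk: "Poly_Mapping.lookup (vertex_exponent k n w) v = of_bool (w = (0, 1) \<or> w = (k, n + 1))" for w
    using kn by (auto simp: vertex_exponent_def ExtraVar lookup_single when_def)
  have "(\<Sum>\<alpha>\<in>arcs (quiver k n). int (c \<alpha>) * of_bool (arrow_head \<alpha> = (0, 1) \<or> arrow_head \<alpha> = (k, n + 1))) =
        (\<Sum>\<alpha>\<in>{Horiz k n}. int (c \<alpha>))"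
  proof (rule sum_arcs_eq[OF c])
    fix \<alpha> assume "\<alpha> \<in> arcs (quiver k n)"
    then show "arrow_head \<alpha> = (0, 1) \<or> arrow_head \<alpha> = (k, n + 1) \<longleftrightarrow> \<alpha> \<in> {Horiz k n}"
      using kn by (cases \<alpha>) (auto simp: Vert_in_arcs Horiz_in_arcs)
  qed simp
  moreover have "(\<Sum>\<alpha>\<in>arcs (quiver k n). int (c \<alpha>) * of_bool (arrow_tail \<alpha> = (0, 1) \<or> arrow_tail \<alpha> = (k, n + 1))) =
        (\<Sum>\<alpha>\<in>{Vert 0 1}. int (c \<alpha>))"
  proof (rule sum_arcs_eq[OF c])
    fix \<alpha> assume "\<alpha> \<in> arcs (quiver k n)"
    then show "arrow_tail \<alpha> = (0, 1) \<or> arrow_tail \<alpha> = (k, n + 1) \<longleftrightarrow> \<alpha> \<in> {Vert 0 1}"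
      using kn by (cases \<alpha>) (auto simp: Vert_in_arcs Horiz_in_arcs)
  qed simp
  moreover note lk' = lk[unfolded ExtraVar]
  ultimately show ?thesis
    by (simp add: arrow_exponent_def lookup_minus lk' right_diff_distrib sum_subtractf ExtraVar net_flow_def)
qed

lemma lookup_arrow_exponent_outside:
  assumes "1 \<le> k" "1 \<le> n" "\<alpha> \<in> arcs (quiver k n)" "v \<notin> lg_vars k n"
  shows "Poly_Mapping.lookup (arrow_exponent k n \<alpha>) v = 0"
proof -
  have "Poly_Mapping.lookup (vertex_exponent k n w) v = 0" if "w \<in> verts (quiver k n)" for w
    using that assms(4) by (auto simp: vertex_exponent_def lg_vars_def quiver_def lookup_single when_def)
  moreover have "arrow_head \<alpha> \<in> verts (quiver k n)" "arrow_tail \<alpha> \<in> verts (quiver k n)"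
    using assms(1-3) by (auto simp: quiver_def)
  ultimately show ?thesis
    by (simp add: arrow_exponent_def lookup_minus)
qed

section \<open>Layer sums and the weight variables\<close>

definition layer_sum :: "nat \<Rightarrow> nat \<Rightarrow> (arrow \<Rightarrow> nat) \<Rightarrow> nat \<Rightarrow> nat" where
  "layer_sum k n c u = (\<Sum>\<alpha> | \<alpha> \<in> arcs (quiver k n) \<and> layer k \<alpha> = u. c \<alpha>)"

lemma layer_sum_row:
  assumes "on_quiver k n c" "1 \<le> n" "i < k"
  shows "layer_sum k n c i = (\<Sum>j = 1..n. c (Vert i j))"
proof -
  have "layer_sum k n c i = (\<Sum>\<alpha>\<in>Vert i ` {1..n}. c \<alpha>)"
    unfolding layer_sum_def
  proof (rule sum.mono_neutral_left)
    show "{\<alpha> \<in> arcs (quiver k n). layer k \<alpha> = i} \<subseteq> Vert i ` {1..n}"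
    proof
      fix \<alpha> assume "\<alpha> \<in> {\<alpha> \<in> arcs (quiver k n). layer k \<alpha> = i}"
      then show "\<alpha> \<in> Vert i ` {1..n}"
        using assms by (cases \<alpha>) (auto simp: Vert_in_arcs Horiz_in_arcs)
    qed
  qed (use assms(1) in \<open>auto simp: on_quiver_def\<close>)
  then show ?thesis by (simp add: sum.reindex inj_on_def)
qed

lemma layer_sum_column:
  assumes "on_quiver k n c" "1 \<le> k" "1 \<le> j" "j \<le> n"
  shows "layer_sum k n c (k + j - 1) = (\<Sum>i = 1..k. c (Horiz i j))"
proof -
  have "layer_sum k n c (k + j - 1) = (\<Sum>\<alpha>\<in>(\<lambda>i. Horiz i j) ` {1..k}. c \<alpha>)"
    unfolding layer_sum_def
  proof (rule sum.mono_neutral_left)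
    show "{\<alpha> \<in> arcs (quiver k n). layer k \<alpha> = k + j - 1} \<subseteq> (\<lambda>i. Horiz i j) ` {1..k}"
    proof
      fix \<alpha> assume "\<alpha> \<in> {\<alpha> \<in> arcs (quiver k n). layer k \<alpha> = k + j - 1}"
      then show "\<alpha> \<in> (\<lambda>i. Horiz i j) ` {1..k}"
        using assms by (cases \<alpha>) (auto simp: Vert_in_arcs Horiz_in_arcs)
    qed
  qed (use assms(1) in \<open>auto simp: on_quiver_def\<close>)
  then show ?thesis by (simp add: sum.reindex inj_on_def)
qed

lemma sum_over_layers:
  assumes "finite U"
  shows "(\<Sum>\<alpha> | \<alpha> \<in> arcs (quiver k n) \<and> layer k \<alpha> \<in> U. c \<alpha>) = (\<Sum>u\<in>U. layer_sum k n c u)"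
proof -
  let ?S = "{\<alpha> \<in> arcs (quiver k n). layer k \<alpha> \<in> U}"
  have "sum c ?S = (\<Sum>u\<in>U. \<Sum>\<alpha> | \<alpha> \<in> ?S \<and> layer k \<alpha> = u. c \<alpha>)"
    by (rule sum.group[symmetric]) (use assms finite_arcs[of k n] in auto)
  also have "\<dots> = (\<Sum>u\<in>U. layer_sum k n c u)"
    unfolding layer_sum_def by (intro sum.cong) auto
  finally show ?thesis .
qed

text \<open>
  The variables along the path \<open>(0,1), (1,1), \<dots>, (k,1), (k,2), \<dots>, (k,n)\<close>. The path crosses each layer
  once, and the \<open>u\<close>-th vertex is its last one before layer \<open>u\<close>.
\<close>

definition path_var :: "nat \<Rightarrow> nat \<Rightarrow> lg_var" where
  "path_var k u = (if u = 0 then ExtraVar else if u \<le> k then EntryVar u 1 else EntryVar k (u - k + 1))"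

lemma path_var_eq_iff: "1 \<le> k \<Longrightarrow> path_var k u = path_var k v \<longleftrightarrow> u = v"
  by (auto simp: path_var_def)

lemma weight_var_path_var:
  "1 \<le> partial_deg d p \<Longrightarrow> weight_var k d p = path_var k (partial_deg d p - 1)"
  by (auto simp: weight_var_def path_var_def Let_def)

lemma telescope_prev:
  fixes f :: "nat \<Rightarrow> int"
  shows "(\<Sum>j = 1..n. f (j - 1) - f j) = f 0 - f n"
  by (induction n) auto

text \<open>
  If the balance fails only on the path, then what is missing in layer \<open>u\<close> compared with the flow
  through the last arrow is what got stuck at the path vertices upstream of that layer. From one
  row or column to the next this is the sum of the balance equations over the vertices between them.
  Passing from the rows to the columns instead uses the first column as a whole, starting again from
  the initial arrow.
\<close>

lemma layer_sum_along_path: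
  assumes kn: "1 \<le> k" "1 \<le> n" and c: "on_quiver k n c"
    and off: "\<And>v. v \<in> lg_vars k n \<Longrightarrow> v \<notin> range (path_var k) \<Longrightarrow> net_flow k n c v = 0"
    and u: "u < k + n - 1"
  shows "int (layer_sum k n c u) = int (c (Horiz k n)) - (\<Sum>r\<le>u. net_flow k n c (path_var k r))"
  using u
proof (induction u)
  case 0
  have "layer_sum k n c 0 = (\<Sum>j = 1..n. c (Vert 0 j))"
    using layer_sum_row[OF c kn(2), of 0] kn by simp
  also have "\<dots> = (\<Sum>j\<in>{1}. c (Vert 0 j))"
    by (rule sum.mono_neutral_right) (use c kn in \<open>auto simp: on_quiver_def Vert_in_arcs\<close>)
  finally have "layer_sum k n c 0 = c (Vert 0 1)" by simp
  then show ?case by (simp add: path_var_def net_flow_def)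
next
  case (Suc u)
  have off': "net_flow k n c (EntryVar i j) = 0"
    if "1 \<le> i" "i < k" "2 \<le> j" "j \<le> n" for i j
    using that by (intro off) (auto simp: lg_vars_def path_var_def split: if_splits)
  consider "Suc u < k" | "Suc u = k" | "k < Suc u" by linarith
  then show ?case
  proof cases
    case 1
    define i where "i = Suc u"
    have "net_flow k n c (EntryVar i 1) = (\<Sum>j = 1..n. net_flow k n c (EntryVar i j))"
      using 1 kn off' by (subst sum.remove[of _ 1]) (auto simp: i_def)
    also have "\<dots> = int (\<Sum>j = 1..n. c (Vert u j)) - int (\<Sum>j = 1..n. c (Vert i j))
                     + (\<Sum>j = 1..n. int (c (Horiz i (j - 1))) - int (c (Horiz i j)))"
      by (simp add: net_flow_def i_def sum.distrib sum_subtractf)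
    also have "(\<Sum>j = 1..n. int (c (Horiz i (j - 1))) - int (c (Horiz i j))) = 0"
      unfolding telescope_prev[of "\<lambda>j. int (c (Horiz i j))"]
      using c 1 kn by (auto simp: on_quiver_def Horiz_in_arcs i_def)
    finally show ?thesis
      using Suc 1 kn layer_sum_row[OF c kn(2), of u] layer_sum_row[OF c kn(2), of i]
      by (simp add: i_def path_var_def)
  next
    case 2
    have "(\<Sum>r = 1..k. net_flow k n c (path_var k r)) = (\<Sum>i = 1..k. net_flow k n c (EntryVar i 1))"
      by (intro sum.cong) (auto simp: path_var_def)
    also have "\<dots> = (\<Sum>i = 1..k. int (c (Vert (i - 1) 1)) - int (c (Vert i 1)))
                     + (\<Sum>i = 1..k. int (c (Horiz i 0))) - int (\<Sum>i = 1..k. c (Horiz i 1))"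
      by (simp add: net_flow_def sum.distrib sum_subtractf)
    also have "(\<Sum>i = 1..k. int (c (Horiz i 0))) = 0"
      using c kn by (auto simp: on_quiver_def Horiz_in_arcs)
    also have "(\<Sum>i = 1..k. int (c (Vert (i - 1) 1)) - int (c (Vert i 1))) = int (c (Vert 0 1))"
      unfolding telescope_prev[of "\<lambda>i. int (c (Vert i 1))"]
      using c kn by (auto simp: on_quiver_def Vert_in_arcs)
    finally have "(\<Sum>r = 1..k. net_flow k n c (path_var k r)) = int (c (Vert 0 1)) - int (layer_sum k n c k)"
      using layer_sum_column[OF c kn(1), of 1] kn by simp
    moreover have "(\<Sum>r\<le>k. net_flow k n c (path_var k r)) =
        net_flow k n c (path_var k 0) + (\<Sum>r = 1..k. net_flow k n c (path_var k r))"
      by (simp add: atMost_atLeast0 sum.atLeast_Suc_atMost)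
    ultimately show ?thesis
      by (simp add: 2 path_var_def net_flow_def)
  next
    case 3
    define j where "j = Suc u - k + 1"
    have j: "2 \<le> j" "j < n" "u = k + (j - 1) - 1" "Suc u = k + j - 1"
      using 3 Suc.prems by (auto simp: j_def)
    have "net_flow k n c (EntryVar k j) = (\<Sum>i = 1..k. net_flow k n c (EntryVar i j))"
      using j kn off' by (subst sum.remove[of _ k]) auto
    also have "\<dots> = (\<Sum>i = 1..k. int (c (Vert (i - 1) j)) - int (c (Vert i j)))
                     + int (\<Sum>i = 1..k. c (Horiz i (j - 1))) - int (\<Sum>i = 1..k. c (Horiz i j))"
      by (simp add: net_flow_def sum.distrib sum_subtractf)
    also have "(\<Sum>i = 1..k. int (c (Vert (i - 1) j)) - int (c (Vert i j))) = 0"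
      unfolding telescope_prev[of "\<lambda>i. int (c (Vert i j))"]
      using c kn j by (auto simp: on_quiver_def Vert_in_arcs)
    finally have "net_flow k n c (EntryVar k j) = int (layer_sum k n c u) - int (layer_sum k n c (Suc u))"
      using layer_sum_column[OF c kn(1), of "j - 1"] layer_sum_column[OF c kn(1), of j] j by simp
    moreover have "path_var k (Suc u) = EntryVar k j"
      using 3 by (simp add: path_var_def j_def)
    ultimately show ?thesis
      using Suc by simp
  qed
qed

text \<open>
  The value of a flow is read off at the last arrow; balance at \<open>ExtraVar\<close> makes the initial arrow
  carry the same amount.
\<close>

definition flows :: "nat \<Rightarrow> nat \<Rightarrow> nat \<Rightarrow> (arrow \<Rightarrow> nat) set" where
  "flows k n m = {c. on_quiver k n c \<and> c (Horiz k n) = m \<and> (\<forall>v\<in>lg_vars k n. net_flow k n c v = 0)}"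

lemma layer_sum_flow:
  assumes "1 \<le> k" "1 \<le> n" "c \<in> flows k n m" "u < k + n"
  shows "layer_sum k n c u = m"
proof (cases "u < k + n - 1")
  case True
  have "net_flow k n c (path_var k r) = 0" if "r \<le> u" for r
  proof -
    have "path_var k r \<in> lg_vars k n"
      using assms(1,2) that True by (auto simp: path_var_def lg_vars_def)
    then show ?thesis using assms(3) by (simp add: flows_def)
  qed
  then show ?thesis
    using layer_sum_along_path[OF assms(1,2) _ _ True, of c] assms(3) by (simp add: flows_def)
next
  case False
  then have u: "u = k + n - 1" using assms by simp
  have c: "on_quiver k n c" "c (Horiz k n) = m" using assms by (auto simp: flows_def)
  have "layer_sum k n c u = (\<Sum>i\<in>{k}. c (Horiz i n))"
    unfolding u layer_sum_column[OF c(1) assms(1,2) order.refl]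
    by (rule sum.mono_neutral_right) (use c assms(1) in \<open>auto simp: on_quiver_def Horiz_in_arcs\<close>)
  then show ?thesis by (simp add: c)
qed

lemma partial_deg_strict_mono:
  assumes "\<And>i. i \<in> {1..l} \<Longrightarrow> d i \<ge> (1::nat)" "p < q" "q \<le> l"
  shows "partial_deg d p < partial_deg d q"
  unfolding partial_deg_def
  by (rule sum_strict_mono2[of _ _ q]) (use assms(2,3) assms(1)[of q] in auto)

lemma partial_deg_mono: "p \<le> q \<Longrightarrow> partial_deg d p \<le> partial_deg d q"
  unfolding partial_deg_def by (intro sum_mono2) auto

lemma partial_deg_step: "1 \<le> p \<Longrightarrow> partial_deg d p = partial_deg d (p - 1) + d p"
  unfolding partial_deg_def by (cases p) auto

lemma block_sum:
  assumes "1 \<le> k" "1 \<le> n" "p \<in> {1..l}" and "(\<Sum>i = 1..l. d i) < k + n"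
  shows "sum c (block k n d p) = (\<Sum>u = partial_deg d (p - 1)..<partial_deg d p. layer_sum k n c u)"
  using sum_over_layers[where U = "{partial_deg d (p - 1)..<partial_deg d p}" and k = k and n = n and c = c]
  unfolding block_layer[OF assms] by simp

text \<open>
  Setting the weight variables to 1 does not create new constant terms. By induction the path
  vertices before the \<open>p\<close>-th weight variable are balanced. The latter lies upstream of the last layer
  of the block \<open>B\<^sub>p\<close> but of no earlier layer of that block, so its imbalance is subtracted exactly
  once from the block total \<open>d\<^sub>p m\<close>; as this total is prescribed, the imbalance is zero. In terms
  of gradings: there is one with weight 1 on the arrows of \<open>B\<^sub>p\<close>, \<open>-d\<^sub>p\<close> on the last arrow (which is \<open>a\<close>)
  and 0 on all others, and the matrix of the weights of the \<open>x\<^sub>q\<close> under these gradings is triangular with diagonal entries \<open>-1\<close>.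
\<close>

lemma net_flow_weight_var:
  assumes kn: "1 \<le> k" "1 \<le> n" and pos: "\<And>i. i \<in> {1..l} \<Longrightarrow> d i \<ge> 1"
    and fano: "(\<Sum>i = 1..l. d i) < k + n"
    and c: "on_quiver k n c"
    and off: "\<And>v. v \<in> lg_vars k n \<Longrightarrow> v \<notin> weight_vars k l d \<Longrightarrow> net_flow k n c v = 0"
    and blocks: "\<And>p. p \<in> {1..l} \<Longrightarrow> sum c (block k n d p) = d p * c (Horiz k n)"
    and p: "p \<in> {1..l}"
  shows "net_flow k n c (weight_var k d p) = 0"
  using p
proof (induction p rule: less_induct)
  case (less p)
  let ?u = "partial_deg d" and ?net = "\<lambda>r. net_flow k n c (path_var k r)"
  have u1: "1 \<le> ?u q" if "q \<in> {1..l}" for q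
    using partial_deg_strict_mono[of l d 0 q, OF pos] that by (simp add: partial_deg_def)
  have wv: "weight_var k d q = path_var k (?u q - 1)" if "q \<in> {1..l}" for q
    using that u1 by (intro weight_var_path_var)
  have off': "net_flow k n c v = 0" if "v \<in> lg_vars k n" "v \<notin> range (path_var k)" for v
    using that wv by (intro off) (auto simp: weight_vars_def)
  have ul: "?u p < k + n"
    using partial_deg_mono[of p l d] less.prems fano by (simp add: partial_deg_def)
  have z: "?net r = 0" if r: "r < ?u p - 1" for r
  proof (cases "path_var k r \<in> weight_vars k l d")
    case True
    then obtain q where q: "q \<in> {1..l}" "path_var k r = weight_var k d q"
      by (auto simp: weight_vars_def)
    then have "r = ?u q - 1" using kn wv by (simp add: path_var_eq_iff)
    then have "?u q < ?u p" using r by simp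
    then have "q < p" using partial_deg_mono[of p q d] by (cases "q < p") auto
    then show ?thesis using less.IH q by simp
  next
    case False
    moreover have "path_var k r \<in> lg_vars k n"
      using r ul kn by (auto simp: path_var_def lg_vars_def)
    ultimately show ?thesis using off by simp
  qed
  have ls: "int (layer_sum k n c u) = int (c (Horiz k n)) - (\<Sum>r\<le>u. ?net r)" if "u < ?u p" for u
    using that ul by (intro layer_sum_along_path kn c off') auto
  have lt: "?u (p - 1) < ?u p"
    using less.prems by (intro partial_deg_strict_mono[of l] pos) auto
  have up: "?u p = ?u (p - 1) + d p"
    using less.prems by (intro partial_deg_step) auto
  let ?w = "?u p - 1"
  have "int (sum c (block k n d p)) = (\<Sum>u = ?u (p - 1)..<?u p. int (layer_sum k n c u))"
    using block_sum[OF kn less.prems fano] by simp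
  also have "\<dots> = (\<Sum>u = ?u (p - 1)..<?u p. int (c (Horiz k n)) - (if u = ?w then ?net ?w else 0))"
  proof (rule sum.cong[OF refl])
    fix u assume u: "u \<in> {?u (p - 1)..<?u p}"
    have "(\<Sum>r\<le>u. ?net r) = (\<Sum>r\<in>{u}. ?net r)"
    proof (rule sum.mono_neutral_right)
      show "\<forall>r\<in>{..u} - {u}. ?net r = 0"
        using u by (auto intro!: z)
    qed auto
    then show "int (layer_sum k n c u) = int (c (Horiz k n)) - (if u = ?w then ?net ?w else 0)"
      using ls[of u] u z[of u] by auto
  qed
  also have "\<dots> = int (d p * c (Horiz k n)) - ?net ?w"
    using lt up by (auto simp: sum_subtractf)
  finally show ?case
    using blocks[OF less.prems] wv[OF less.prems] by simp
qed

text \<open>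
  The arrows leaving the rectangle with corners \<open>(1,1)\<close> and \<open>(i,j)\<close> carry the \<open>m\<close> units that enter it at
  \<open>(1,1)\<close>. For \<open>i = 0\<close> the rectangle is empty and the initial arrow is the only one counted.
\<close>

lemma flow_through_corner:
  assumes "1 \<le> k" "c \<in> flows k n m" "i \<le> k" "1 \<le> j" "j \<le> n" "(i, j) \<noteq> (k, n)"
  shows "(\<Sum>j' = 1..j. c (Vert i j')) + (\<Sum>i' = 1..i. c (Horiz i' j)) = m"
  using assms(3,6)
proof (induction i)
  case 0
  have c: "on_quiver k n c" "c (Vert 0 1) = m"
    using assms(2) by (auto simp: flows_def lg_vars_def net_flow_def)
  have "(\<Sum>j' = 1..j. c (Vert 0 j')) = (\<Sum>j'\<in>{1}. c (Vert 0 j'))"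
    by (rule sum.mono_neutral_right) (use c assms(4) in \<open>auto simp: on_quiver_def Vert_in_arcs\<close>)
  then show ?case using c(2) by simp
next
  case (Suc i)
  have c: "on_quiver k n c" using assms(2) by (auto simp: flows_def)
  have "net_flow k n c (EntryVar (Suc i) j') = 0" if "j' \<in> {1..j}" for j'
    using assms(2,5) that Suc.prems by (auto simp: flows_def lg_vars_def)
  then have "0 = (\<Sum>j' = 1..j. net_flow k n c (EntryVar (Suc i) j'))"
    by simp
  also have "\<dots> = int (\<Sum>j' = 1..j. c (Vert i j')) - int (\<Sum>j' = 1..j. c (Vert (Suc i) j'))
                   + (\<Sum>j' = 1..j. int (c (Horiz (Suc i) (j' - 1))) - int (c (Horiz (Suc i) j')))"
    by (simp add: net_flow_def sum.distrib sum_subtractf)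
  also have "(\<Sum>j' = 1..j. int (c (Horiz (Suc i) (j' - 1))) - int (c (Horiz (Suc i) j'))) =
             - int (c (Horiz (Suc i) j))"
    unfolding telescope_prev[of "\<lambda>j'. int (c (Horiz (Suc i) j'))"]
    using c assms by (auto simp: on_quiver_def Horiz_in_arcs)
  finally have "int (\<Sum>j' = 1..j. c (Vert (Suc i) j')) + int (c (Horiz (Suc i) j)) =
                int (\<Sum>j' = 1..j. c (Vert i j'))" by simp
  moreover have "int (\<Sum>j' = 1..j. c (Vert i j')) + int (\<Sum>i' = 1..i. c (Horiz i' j)) = int m"
    unfolding of_nat_add[symmetric] using Suc by simp
  ultimately have "int ((\<Sum>j' = 1..j. c (Vert (Suc i) j')) + (\<Sum>i' = 1..Suc i. c (Horiz i' j))) = int m"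
    by simp
  then show ?case by (simp only: of_nat_eq_iff)
qed

section \<open>Flows as differences of potentials\<close>

text \<open>
  The families \<open>s\<close> are functions on the bounded faces between the rows and columns of the quiver;
  \<^const>\<open>bdry\<close> gives the value \<open>m\<close> to the outer region above and to the right, and the outer region below
  and to the left, on the other side of every flow, gets the value 0.
\<close>

definition potential :: "nat \<Rightarrow> nat \<Rightarrow> nat \<Rightarrow> (nat \<times> nat \<Rightarrow> nat) \<Rightarrow> nat \<Rightarrow> nat \<Rightarrow> nat" where
  "potential k n m s i j = (if i = 0 \<or> j = 0 then 0 else bdry k n m s i j)"

definition patterns :: "nat \<Rightarrow> nat \<Rightarrow> nat \<Rightarrow> (nat \<times> nat \<Rightarrow> nat) set" where
  "patterns k n m = {s \<in> ({1..k - 1} \<times> {1..n - 1}) \<rightarrow>\<^sub>E UNIV.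
     \<forall>i\<in>{1..k - 1}. \<forall>j\<in>{1..n - 1}.
       s (i, j) \<le> bdry k n m s (i + 1) j \<and> s (i, j) \<le> bdry k n m s i (j + 1)}"

text \<open>
  The flow along an arrow is the difference of the potentials of the two faces next to it. The row
  index is reversed because the family indexing the binomials increases in both directions,
  while the amount of flow leaving a row within the first \<open>j\<close> columns decreases from row to row.
\<close>

definition flow_of :: "nat \<Rightarrow> nat \<Rightarrow> nat \<Rightarrow> (nat \<times> nat \<Rightarrow> nat) \<Rightarrow> arrow \<Rightarrow> nat" where
  "flow_of k n m s \<alpha> = (if \<alpha> \<in> arcs (quiver k n) then (case \<alpha> of
     Vert i j \<Rightarrow> potential k n m s (k - i) j - potential k n m s (k - i) (j - 1)
   | Horiz i j \<Rightarrow> potential k n m s (k - i + 1) j - potential k n m s (k - i) j) else 0)"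

definition pattern_of :: "nat \<Rightarrow> nat \<Rightarrow> (arrow \<Rightarrow> nat) \<Rightarrow> nat \<times> nat \<Rightarrow> nat" where
  "pattern_of k n c = (\<lambda>(i, j)\<in>{1..k - 1} \<times> {1..n - 1}. \<Sum>j' = 1..j. c (Vert (k - i) j'))"

lemma potential_mono:
  assumes "s \<in> patterns k n m"
  shows "i < k \<Longrightarrow> j \<le> n \<Longrightarrow> potential k n m s i j \<le> potential k n m s (i + 1) j"
    and "i \<le> k \<Longrightarrow> j < n \<Longrightarrow> potential k n m s i j \<le> potential k n m s i (j + 1)"
proof -
  have *: "s (i, j) \<le> bdry k n m s (i + 1) j \<and> s (i, j) \<le> bdry k n m s i (j + 1)"
    if "1 \<le> i" "i < k" "1 \<le> j" "j < n" for i j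
    using assms that by (auto simp: patterns_def)
  show "i < k \<Longrightarrow> j \<le> n \<Longrightarrow> potential k n m s i j \<le> potential k n m s (i + 1) j"
    using *[of i j] by (auto simp: potential_def bdry_def split: if_splits)
  show "i \<le> k \<Longrightarrow> j < n \<Longrightarrow> potential k n m s i j \<le> potential k n m s i (j + 1)"
    using *[of i j] by (auto simp: potential_def bdry_def split: if_splits)
qed

text \<open>
  The formulas for \<^const>\<open>flow_of\<close> extend to the nonexistent arrows next to the grid, where both
  potentials agree. This avoids boundary cases in the balance equations.
\<close>

lemma flow_of_Vert:
  assumes "i \<le> k" "1 \<le> j" "j \<le> n"
  shows "flow_of k n m s (Vert i j) = potential k n m s (k - i) j - potential k n m s (k - i) (j - 1)"
  using assms by (auto simp: flow_of_def Vert_in_arcs potential_def bdry_def)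

lemma flow_of_Horiz:
  assumes "1 \<le> i" "i \<le> k" "j \<le> n"
  shows "flow_of k n m s (Horiz i j) = potential k n m s (k - i + 1) j - potential k n m s (k - i) j"
  using assms by (auto simp: flow_of_def Horiz_in_arcs potential_def bdry_def)

lemma flow_of_in_flows:
  assumes kn: "1 \<le> k" "1 \<le> n" and s: "s \<in> patterns k n m"
  shows "flow_of k n m s \<in> flows k n m"
proof -
  let ?c = "flow_of k n m s" and ?b = "potential k n m s"
  have ends: "?c (Horiz k n) = m" "?c (Vert 0 1) = m"
    using kn by (auto simp: flow_of_Vert flow_of_Horiz potential_def bdry_def)
  have "net_flow k n ?c v = 0" if v: "v \<in> lg_vars k n" for v
  proof (cases v)
    case (EntryVar i j)
    then have ij: "1 \<le> i" "i \<le> k" "1 \<le> j" "j \<le> n"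
      using v by (auto simp: lg_vars_def)
    define I where "I = k - i"
    have I: "k - (i - 1) = I + 1" "I < k" using ij by (auto simp: I_def)
    have eqs: "?c (Vert (i - 1) j) = ?b (I + 1) j - ?b (I + 1) (j - 1)"
      "?c (Horiz i (j - 1)) = ?b (I + 1) (j - 1) - ?b I (j - 1)"
      "?c (Vert i j) = ?b I j - ?b I (j - 1)"
      "?c (Horiz i j) = ?b (I + 1) j - ?b I j"
    proof -
      have "i - 1 \<le> k" "j - 1 \<le> n" using ij by auto
      then show "?c (Vert (i - 1) j) = ?b (I + 1) j - ?b (I + 1) (j - 1)"
        "?c (Horiz i (j - 1)) = ?b (I + 1) (j - 1) - ?b I (j - 1)"
        "?c (Vert i j) = ?b I j - ?b I (j - 1)"
        "?c (Horiz i j) = ?b (I + 1) j - ?b I j"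
        using ij by (simp_all only: flow_of_Vert flow_of_Horiz I(1) I_def[symmetric])
    qed
    have mono: "?b I j \<le> ?b (I + 1) j" "?b I (j - 1) \<le> ?b (I + 1) (j - 1)"
      "?b I (j - 1) \<le> ?b I j" "?b (I + 1) (j - 1) \<le> ?b (I + 1) j"
      using potential_mono(1)[OF s, of I j] potential_mono(1)[OF s, of I "j - 1"]
        potential_mono(2)[OF s, of I "j - 1"] potential_mono(2)[OF s, of "I + 1" "j - 1"] I ij
      by auto
    show ?thesis
      unfolding net_flow_def EntryVar lg_var.case eqs of_nat_diff[OF mono(1)]
        of_nat_diff[OF mono(2)] of_nat_diff[OF mono(3)] of_nat_diff[OF mono(4)]
      by simp
  qed (use ends in \<open>simp add: net_flow_def\<close>)
  then show ?thesis
    using ends by (simp add: flows_def on_quiver_def flow_of_def)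
qed

text \<open>
  The boundary values of the potential are automatic: for \<open>i = k\<close> only the initial arrow
  contributes, and for \<open>j = n\<close> the whole flow has to leave the row vertically.
\<close>

lemma potential_pattern_of:
  assumes kn: "1 \<le> k" "1 \<le> n" and c: "c \<in> flows k n m" and ij: "i \<le> k" "j \<le> n"
  shows "potential k n m (pattern_of k n c) i j = (\<Sum>j' = 1..j. c (Vert (k - i) j'))"
proof -
  have oq: "on_quiver k n c" using c by (simp add: flows_def)
  consider "i = 0" | "j = 0" | "1 \<le> i" "i < k" "1 \<le> j" "j < n"
    | "1 \<le> i" "1 \<le> j" "i = k \<or> j = n"
    using ij by linarith
  then show ?thesis
  proof cases
    case 1
    then show ?thesis using oq kn by (auto simp: potential_def on_quiver_def Vert_in_arcs)
  next
    case 2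
    then show ?thesis by (simp add: potential_def)
  next
    case 3
    then have "i \<in> {1..k - 1}" "j \<in> {1..n - 1}" by auto
    then show ?thesis using 3 by (simp add: potential_def bdry_def pattern_of_def)
  next
    case 4
    have "(\<Sum>i' = 1..k - i. c (Horiz i' j)) = 0"
      using oq 4 ij by (auto simp: on_quiver_def Horiz_in_arcs)
    then show ?thesis
      using flow_through_corner[OF kn(1) c, of "k - i" j] 4 ij
      by (auto simp: potential_def bdry_def)
  qed
qed

text \<open>
  The same potential described by horizontal arrows: what has not left the rectangle downwards
  leaves it to the right.
\<close>

lemma potential_pattern_of_columns:
  assumes kn: "1 \<le> k" "1 \<le> n" and c: "c \<in> flows k n m" and ij: "i \<le> k" "1 \<le> j" "j \<le> n"
    "(i, j) \<noteq> (0, n)"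
  shows "potential k n m (pattern_of k n c) i j + (\<Sum>i' = 1..k - i. c (Horiz i' j)) = m"
proof -
  have "(k - i, j) \<noteq> (k, n)"
    using ij kn by (cases "i = 0") auto
  then show ?thesis
    using flow_through_corner[OF kn(1) c, of "k - i" j] ij
    by (simp add: potential_pattern_of[OF kn c])
qed

lemma pattern_of_in_patterns:
  assumes kn: "1 \<le> k" "1 \<le> n" and c: "c \<in> flows k n m"
  shows "pattern_of k n c \<in> patterns k n m"
proof -
  let ?s = "pattern_of k n c"
  have "?s (i, j) \<le> bdry k n m ?s (i + 1) j \<and> ?s (i, j) \<le> bdry k n m ?s i (j + 1)"
    if "i \<in> {1..k - 1}" "j \<in> {1..n - 1}" for i j
  proof -
    have ij: "1 \<le> i" "i < k" "1 \<le> j" "j < n" using that by auto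
    have e: "?s (i, j) = potential k n m ?s i j"
      "bdry k n m ?s (i + 1) j = potential k n m ?s (i + 1) j"
      "bdry k n m ?s i (j + 1) = potential k n m ?s i (j + 1)"
      using ij by (auto simp: potential_def bdry_def)
    have "potential k n m ?s i j \<le> potential k n m ?s i (j + 1)"
      using ij by (simp add: potential_pattern_of[OF kn c])
    moreover have "(\<Sum>i' = 1..k - (i + 1). c (Horiz i' j)) \<le> (\<Sum>i' = 1..k - i. c (Horiz i' j))"
      by (intro sum_mono2) auto
    then have "potential k n m ?s i j \<le> potential k n m ?s (i + 1) j"
      using potential_pattern_of_columns[OF kn c, of i j]
        potential_pattern_of_columns[OF kn c, of "i + 1" j] ij by simp
    ultimately show ?thesis by (simp only: e)
  qed
  then show ?thesis
    by (auto simp: patterns_def pattern_of_def)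
qed

lemma flow_of_pattern_of:
  assumes kn: "1 \<le> k" "1 \<le> n" and c: "c \<in> flows k n m"
  shows "flow_of k n m (pattern_of k n c) = c"
proof
  fix \<alpha>
  let ?b = "potential k n m (pattern_of k n c)"
  have oq: "on_quiver k n c" "c (Horiz k n) = m" using c by (auto simp: flows_def)
  show "flow_of k n m (pattern_of k n c) \<alpha> = c \<alpha>"
  proof (cases "\<alpha> \<in> arcs (quiver k n)")
    case False
    then show ?thesis using oq by (simp add: flow_of_def on_quiver_def)
  next
    case True
    show ?thesis
    proof (cases \<alpha>)
      case (Vert i j)
      then have ij: "i < k" "1 \<le> j" "j \<le> n" using True kn by (auto simp: Vert_in_arcs)
      then have "?b (k - i) j = ?b (k - i) (j - 1) + c (Vert i j)"
        using sum.nat_ivl_Suc'[of 1 "j - 1" "\<lambda>j'. c (Vert i j')"]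
        by (simp add: potential_pattern_of[OF kn c])
      then show ?thesis
        using ij by (simp add: Vert flow_of_Vert)
    next
      case (Horiz i j)
      then have ij: "1 \<le> i" "i \<le> k" "1 \<le> j" "j \<le> n" using True kn by (auto simp: Horiz_in_arcs)
      have *: "flow_of k n m (pattern_of k n c) \<alpha> = ?b (k - i + 1) j - ?b (k - i) j"
        using ij by (simp add: Horiz flow_of_Horiz)
      show ?thesis
      proof (cases "j = n")
        case True
        then have "i = k" using \<open>\<alpha> \<in> arcs _\<close> kn by (auto simp: Horiz Horiz_in_arcs)
        then show ?thesis
          unfolding * using oq kn True by (simp add: Horiz potential_def bdry_def)
      next
        case False
        have "(\<Sum>i' = 1..i. c (Horiz i' j)) = (\<Sum>i' = 1..i - 1. c (Horiz i' j)) + c (Horiz i j)"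
          using ij sum.nat_ivl_Suc'[of 1 "i - 1" "\<lambda>i'. c (Horiz i' j)"] by simp
        then show ?thesis
          unfolding * using kn potential_pattern_of_columns[OF kn c, of "k - i + 1" j]
            potential_pattern_of_columns[OF kn c, of "k - i" j] ij False
          by (simp add: Horiz Suc_le_eq)
      qed
    qed
  qed
qed

lemma telescope_mono:
  fixes b :: "nat \<Rightarrow> nat"
  assumes "\<And>i. i < n \<Longrightarrow> b i \<le> b (i + 1)"
  shows "(\<Sum>i = 1..n. b i - b (i - 1)) = b n - b 0 \<and> b 0 \<le> b n"
  using assms
proof (induction n)
  case (Suc n)
  have "(\<Sum>i = 1..n. b i - b (i - 1)) = b n - b 0 \<and> b 0 \<le> b n"
    by (rule Suc.IH) (use Suc.prems in simp)
  moreover have "b n \<le> b (Suc n)"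
    using Suc.prems[of n] by simp
  ultimately show ?case by simp
qed simp

lemma pattern_of_flow_of:
  assumes kn: "1 \<le> k" "1 \<le> n" and s: "s \<in> patterns k n m"
  shows "pattern_of k n (flow_of k n m s) = s"
proof
  fix x :: "nat \<times> nat"
  obtain i j where x: "x = (i, j)" by force
  show "pattern_of k n (flow_of k n m s) x = s x"
  proof (cases "x \<in> {1..k - 1} \<times> {1..n - 1}")
    case False
    have "s \<in> ({1..k - 1} \<times> {1..n - 1}) \<rightarrow>\<^sub>E UNIV" using s by (simp add: patterns_def)
    then have "s x = undefined" using False by (rule PiE_arb)
    then show ?thesis using False unfolding pattern_of_def by (simp only: restrict_apply if_False)
  next
    case True
    then have ij: "1 \<le> i" "i < k" "1 \<le> j" "j < n" by (auto simp: x)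
    have "pattern_of k n (flow_of k n m s) x =
          (\<Sum>j' = 1..j. potential k n m s i j' - potential k n m s i (j' - 1))"
      using ij True by (simp add: x pattern_of_def flow_of_Vert)
    also have "\<dots> = potential k n m s i j - potential k n m s i 0"
      using telescope_mono[of j "potential k n m s i"] potential_mono(2)[OF s, of i] ij by auto
    also have "\<dots> = s x" using ij by (simp add: potential_def bdry_def x)
    finally show ?thesis .
  qed
qed

lemma flows_bij_patterns:
  assumes "1 \<le> k" "1 \<le> n"
  shows "bij_betw (flow_of k n m) (patterns k n m) (flows k n m)"
  by (rule bij_betw_byWitness[where f' = "pattern_of k n"])
     (use assms pattern_of_flow_of flow_of_pattern_of flow_of_in_flows pattern_of_in_patterns in auto)

section \<open>The weights of flows\<close>

text \<open>
  A multinomial coefficient as a product of binomial coefficients of consecutive partial sums.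
\<close>

lemma prod_fact_increments_binomials:
  fixes b :: "nat \<Rightarrow> nat"
  assumes "1 \<le> n" "b 0 = 0" "\<And>i. i < n \<Longrightarrow> b i \<le> b (i + 1)"
  shows "(\<Prod>i = 1..n. fact (b i - b (i - 1))) * (\<Prod>i = 1..n - 1. b (i + 1) choose b i) = (fact (b n) :: nat)"
  using assms(1,3)
proof (induction n rule: dec_induct)
  case base
  then show ?case by (simp add: assms(2))
next
  case (step n)
  define A where "A = (\<Prod>i = 1..n. fact (b i - b (i - 1)) :: nat)"
  define B where "B = (\<Prod>i = 1..n - 1. b (i + 1) choose b i)"
  have IH: "A * B = fact (b n)"
    unfolding A_def B_def using step by auto
  have 1: "(\<Prod>i = 1..Suc n. fact (b i - b (i - 1))) = A * fact (b (Suc n) - b n)"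
    by (simp add: A_def)
  have 2: "(\<Prod>i = 1..Suc n - 1. b (i + 1) choose b i) = B * (b (Suc n) choose b n)"
    using step.hyps by (cases n) (auto simp: B_def)
  have "b n \<le> b (Suc n)" using step.prems[of n] by simp
  then have "fact (b n) * fact (b (Suc n) - b n) * (b (Suc n) choose b n) = (fact (b (Suc n)) :: nat)"
    by (rule binomial_fact_lemma)
  then show ?case
    unfolding 1 2 IH[symmetric] by (simp add: algebra_simps)
qed

text \<open>
  Each row from 1 to \<open>k - 1\<close> and each column from 1 to \<open>n - 1\<close> contributes \<open>m!\<close>
  by the preceding lemma; two more factors come from the initial and the last arrow.
\<close>

lemma flow_weight_times_pattern_weight:
  assumes kn: "1 \<le> k" "1 \<le> n" and s: "s \<in> patterns k n m"
  shows "(\<Prod>\<alpha>\<in>arcs (quiver k n). fact (flow_of k n m s \<alpha>)) *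
     (\<Prod>i = 1..k - 1. \<Prod>j = 1..n - 1.
        (bdry k n m s (i + 1) j choose bdry k n m s i j) *
        (bdry k n m s i (j + 1) choose bdry k n m s i j)) = (fact m ^ (k + n) :: nat)"
proof -
  let ?c = "flow_of k n m s" and ?b = "potential k n m s" and ?B = "bdry k n m s"
  have b: "?B i j = ?b i j" if "1 \<le> i" "1 \<le> j" for i j
    using that by (simp add: potential_def)
  have ends: "?c (Vert 0 1) = m" "?c (Horiz k n) = m"
    using kn by (auto simp: flow_of_Vert flow_of_Horiz potential_def bdry_def)
  have rows: "(\<Prod>i = 1..k - 1. \<Prod>j = 1..n. fact (?c (Vert i j)) :: nat) *
        (\<Prod>i = 1..k - 1. \<Prod>j = 1..n - 1. ?B i (j + 1) choose ?B i j) = fact m ^ (k - 1)"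
  proof -
    have "(\<Prod>i = 1..k - 1. \<Prod>j = 1..n. fact (?c (Vert i j)) :: nat) =
          (\<Prod>i = 1..k - 1. \<Prod>j = 1..n. fact (?c (Vert (k - i) j)))"
      by (subst prod.atLeastAtMost_rev) (rule prod.cong, use kn in auto)
    also have "\<dots> = (\<Prod>i = 1..k - 1. \<Prod>j = 1..n. fact (?b i j - ?b i (j - 1)))"
      by (intro prod.cong refl) (auto simp: flow_of_Vert)
    finally have "(\<Prod>i = 1..k - 1. \<Prod>j = 1..n. fact (?c (Vert i j)) :: nat) *
        (\<Prod>i = 1..k - 1. \<Prod>j = 1..n - 1. ?B i (j + 1) choose ?B i j) =
        (\<Prod>i = 1..k - 1. (\<Prod>j = 1..n. fact (?b i j - ?b i (j - 1))) *
           (\<Prod>j = 1..n - 1. ?b i (j + 1) choose ?b i j))"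
      by (simp add: prod.distrib b)
    also have "\<dots> = (\<Prod>i = 1..k - 1. fact m)"
    proof (rule prod.cong[OF refl])
      fix i assume i: "i \<in> {1..k - 1}"
      have "(\<Prod>j = 1..n. fact (?b i j - ?b i (j - 1))) * (\<Prod>j = 1..n - 1. ?b i (j + 1) choose ?b i j)
            = (fact (?b i n) :: nat)"
      proof (rule prod_fact_increments_binomials)
        show "?b i 0 = 0" by (simp add: potential_def)
        show "?b i j \<le> ?b i (j + 1)" if "j < n" for j
          using that i by (intro potential_mono(2)[OF s]) auto
      qed (use kn in simp)
      then show "(\<Prod>j = 1..n. fact (?b i j - ?b i (j - 1))) * (\<Prod>j = 1..n - 1. ?b i (j + 1) choose ?b i j)
            = (fact m :: nat)"
        using kn i by (simp add: potential_def bdry_def)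
    qed
    finally show ?thesis by simp
  qed
  have columns: "(\<Prod>j = 1..n - 1. \<Prod>i = 1..k. fact (?c (Horiz i j)) :: nat) *
        (\<Prod>i = 1..k - 1. \<Prod>j = 1..n - 1. ?B (i + 1) j choose ?B i j) = fact m ^ (n - 1)"
  proof -
    have "(\<Prod>i = 1..k. fact (?c (Horiz i j)) :: nat) = (\<Prod>i = 1..k. fact (?b i j - ?b (i - 1) j))"
      if "j \<in> {1..n - 1}" for j
    proof -
      have "(\<Prod>i = 1..k. fact (?c (Horiz i j)) :: nat) = (\<Prod>i = 1..k. fact (?c (Horiz (k + 1 - i) j)))"
        by (subst prod.atLeastAtMost_rev) (rule prod.cong, use kn in auto)
      also have "\<dots> = (\<Prod>i = 1..k. fact (?b i j - ?b (i - 1) j))"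
      proof (rule prod.cong[OF refl])
        fix i assume i: "i \<in> {1..k}"
        then have "k - (k + 1 - i) = i - 1" by auto
        then show "fact (?c (Horiz (k + 1 - i) j)) = (fact (?b i j - ?b (i - 1) j) :: nat)"
          using i that flow_of_Horiz[of "k + 1 - i" k j n m s] by auto
      qed
      finally show ?thesis .
    qed
    then have "(\<Prod>j = 1..n - 1. \<Prod>i = 1..k. fact (?c (Horiz i j)) :: nat) =
        (\<Prod>j = 1..n - 1. \<Prod>i = 1..k. fact (?b i j - ?b (i - 1) j))"
      by (rule prod.cong[OF refl])
    moreover have "(\<Prod>i = 1..k - 1. \<Prod>j = 1..n - 1. ?B (i + 1) j choose ?B i j) =
        (\<Prod>j = 1..n - 1. \<Prod>i = 1..k - 1. ?b (i + 1) j choose ?b i j)"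
      by (subst prod.swap) (simp add: b)
    ultimately have "(\<Prod>j = 1..n - 1. \<Prod>i = 1..k. fact (?c (Horiz i j)) :: nat) *
        (\<Prod>i = 1..k - 1. \<Prod>j = 1..n - 1. ?B (i + 1) j choose ?B i j) =
        (\<Prod>j = 1..n - 1. (\<Prod>i = 1..k. fact (?b i j - ?b (i - 1) j)) *
           (\<Prod>i = 1..k - 1. ?b (i + 1) j choose ?b i j))"
      by (simp add: prod.distrib)
    also have "\<dots> = (\<Prod>j = 1..n - 1. fact m)"
    proof (rule prod.cong[OF refl])
      fix j assume j: "j \<in> {1..n - 1}"
      have "(\<Prod>i = 1..k. fact (?b i j - ?b (i - 1) j)) * (\<Prod>i = 1..k - 1. ?b (i + 1) j choose ?b i j)
            = (fact (?b k j) :: nat)"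
      proof (rule prod_fact_increments_binomials[of k "\<lambda>i. ?b i j"])
        show "?b 0 j = 0" by (simp add: potential_def)
        show "?b i j \<le> ?b (i + 1) j" if "i < k" for i
          using that j by (intro potential_mono(1)[OF s]) auto
      qed (use kn in simp)
      then show "(\<Prod>i = 1..k. fact (?b i j - ?b (i - 1) j)) * (\<Prod>i = 1..k - 1. ?b (i + 1) j choose ?b i j)
            = (fact m :: nat)"
        using kn j by (simp add: potential_def bdry_def)
    qed
    finally show ?thesis by simp
  qed
  have "k + n = 1 + 1 + (k - 1) + (n - 1)" using kn by simp
  then have "(fact m ^ (k + n) :: nat) = fact m * fact m * fact m ^ (k - 1) * fact m ^ (n - 1)"
    by (metis power_add power_one_right)
  then show ?thesis
    unfolding rows[symmetric] columns[symmetric] prod_arcs[OF kn] ends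
    by (simp add: prod.distrib mult_ac)
qed

text \<open>Every arrow lies in a layer, through which \<open>m\<close> units pass.\<close>

lemma finite_flows:
  assumes "1 \<le> k" "1 \<le> n"
  shows "finite (flows k n m)"
proof (rule finite_bounded_support[OF finite_arcs[of k n], of _ m])
  fix c \<alpha> assume c: "c \<in> flows k n m" and "\<alpha> \<in> arcs (quiver k n)"
  then have "c \<alpha> \<le> layer_sum k n c (layer k \<alpha>)"
    unfolding layer_sum_def by (intro member_le_sum) (auto simp: finite_arcs)
  moreover have "layer k \<alpha> < k + n"
    using \<open>\<alpha> \<in> _\<close> assms by (cases \<alpha>) (auto simp: Vert_in_arcs Horiz_in_arcs)
  ultimately show "c \<alpha> \<le> m"
    using layer_sum_flow[OF assms c] by simp
qed (auto simp: flows_def on_quiver_def)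

text \<open>
  A family violating one of the inequalities makes a binomial coefficient vanish, so the infinite sum
  is the finite sum over potentials, that is, over flows.
\<close>

lemma I0_coeff_flows:
  assumes kn: "1 \<le> k" "1 \<le> n"
  shows "I0_coeff k n l d m =
     (\<Prod>i = 0..l. fact (ext_deg k n l d i * m)) *
     (\<Sum>c\<in>flows k n m. 1 / (\<Prod>\<alpha>\<in>arcs (quiver k n). fact (c \<alpha>)))"
proof -
  define D :: complex where "D = (\<Prod>i = 0..l. fact (ext_deg k n l d i * m))"
  let ?W = "\<lambda>s. \<Prod>i = 1..k - 1. \<Prod>j = 1..n - 1.
        (bdry k n m s (i + 1) j choose bdry k n m s i j) *
        (bdry k n m s i (j + 1) choose bdry k n m s i j)"
  have fin: "finite (patterns k n m)"
    using bij_betw_finite[OF flows_bij_patterns[OF kn]] finite_flows[OF kn] by blast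
  have "I0_coeff k n l d m =
    (\<Sum>\<^sub>\<infinity>s\<in>({1..k - 1} \<times> {1..n - 1}) \<rightarrow>\<^sub>E UNIV. D / fact m ^ (k + n) * of_nat (?W s))"
    by (simp add: I0_coeff_def D_def)
  also have "\<dots> = (\<Sum>\<^sub>\<infinity>s\<in>patterns k n m. D / fact m ^ (k + n) * of_nat (?W s))"
  proof (rule infsum_cong_neutral)
    fix s assume "s \<in> (({1..k - 1} \<times> {1..n - 1}) \<rightarrow>\<^sub>E UNIV) - patterns k n m"
    then obtain i j where ij: "i \<in> {1..k - 1}" "j \<in> {1..n - 1}"
      "\<not> (s (i, j) \<le> bdry k n m s (i + 1) j \<and> s (i, j) \<le> bdry k n m s i (j + 1))"
      by (auto simp: patterns_def)
    then have "bdry k n m s i j = s (i, j)" by (auto simp: bdry_def)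
    then have "(bdry k n m s (i + 1) j choose bdry k n m s i j) *
        (bdry k n m s i (j + 1) choose bdry k n m s i j) = 0"
      using ij(3) by (auto simp: not_le)
    then have "?W s = 0" using ij(1,2) by (intro prod_zero bexI[of _ i] bexI[of _ j]) auto
    then show "D / fact m ^ (k + n) * of_nat (?W s) = 0" by simp
  qed (auto simp: patterns_def)
  also have "\<dots> = (\<Sum>s\<in>patterns k n m. D / fact m ^ (k + n) * of_nat (?W s))"
    using fin by simp
  also have "\<dots> = (\<Sum>s\<in>patterns k n m. D * (1 / (\<Prod>\<alpha>\<in>arcs (quiver k n). fact (flow_of k n m s \<alpha>))))"
  proof (rule sum.cong[OF refl])
    fix s assume s: "s \<in> patterns k n m"
    define P :: nat where "P = (\<Prod>\<alpha>\<in>arcs (quiver k n). fact (flow_of k n m s \<alpha>))"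
    define w where "w = ?W s"
    have "P * w = fact m ^ (k + n)"
      unfolding P_def w_def by (rule flow_weight_times_pattern_weight[OF kn s])
    then have "of_nat (P * w) = (of_nat (fact m ^ (k + n)) :: complex)"
      by (rule arg_cong)
    then have Pw: "of_nat P * of_nat w = (fact m ^ (k + n) :: complex)"
      by (simp only: of_nat_mult of_nat_power of_nat_fact)
    moreover have "fact m ^ (k + n) \<noteq> (0 :: complex)" by simp
    ultimately have "of_nat P \<noteq> (0 :: complex)" "of_nat w \<noteq> (0 :: complex)"
      by (metis mult_zero_left, metis mult_zero_right)
    moreover have "(\<Prod>\<alpha>\<in>arcs (quiver k n). fact (flow_of k n m s \<alpha>)) = (of_nat P :: complex)"
      by (simp add: P_def)
    ultimately show "D / fact m ^ (k + n) * of_nat (?W s) =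
        D * (1 / (\<Prod>\<alpha>\<in>arcs (quiver k n). fact (flow_of k n m s \<alpha>)))"
      unfolding w_def[symmetric] Pw[symmetric] by simp
  qed
  also have "\<dots> = D * (\<Sum>c\<in>flows k n m. 1 / (\<Prod>\<alpha>\<in>arcs (quiver k n). fact (c \<alpha>)))"
    unfolding sum_distrib_left by (rule sum.reindex_bij_betw[OF flows_bij_patterns[OF kn]])
  finally show ?thesis by (simp add: D_def)
qed

section \<open>Constant terms of powers of the Laurent polynomial\<close>

lemma partial_deg_interval:
  "t < partial_deg d l \<Longrightarrow> \<exists>p\<in>{1..l}. partial_deg d (p - 1) \<le> t \<and> t < partial_deg d p"
proof (induction l)
  case 0
  then show ?case by (simp add: partial_deg_def)
next
  case (Suc l)
  show ?case
  proof (cases "t < partial_deg d l")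
    case True
    then obtain p where "p \<in> {1..l}" "partial_deg d (p - 1) \<le> t" "t < partial_deg d p"
      using Suc.IH by blast
    then show ?thesis by (intro bexI[of _ p]) auto
  next
    case False
    then show ?thesis using Suc.prems by (intro bexI[of _ "Suc l"]) auto
  qed
qed

text \<open>
  The partition of the arrows according to the factors of \<^const>\<open>f_LG\<close>: the index 0 stands for the summand
  \<open>A\<close>, the indices from 1 to \<open>l\<close> for the blocks, and the index \<open>l + 1\<close> for the last arrow, whose
  monomial is the factor \<open>a\<close>.
\<close>

definition part_layers :: "nat \<Rightarrow> nat \<Rightarrow> nat \<Rightarrow> (nat \<Rightarrow> nat) \<Rightarrow> nat \<Rightarrow> nat set" where
  "part_layers k n l d q =
     (if q = 0 then {partial_deg d l..<k + n - 1}
      else if q \<le> l then {partial_deg d (q - 1)..<partial_deg d q}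
      else {k + n - 1})"

definition part :: "nat \<Rightarrow> nat \<Rightarrow> nat \<Rightarrow> (nat \<Rightarrow> nat) \<Rightarrow> nat \<Rightarrow> arrow set" where
  "part k n l d q = {\<alpha> \<in> arcs (quiver k n). layer k \<alpha> \<in> part_layers k n l d q}"

lemma layer_less:
  assumes "1 \<le> k" "1 \<le> n" "\<alpha> \<in> arcs (quiver k n)"
  shows "layer k \<alpha> < k + n"
  using assms by (cases \<alpha>) (auto simp: Vert_in_arcs Horiz_in_arcs)

lemma layer_eq_last_iff:
  assumes "1 \<le> k" "1 \<le> n" "\<alpha> \<in> arcs (quiver k n)"
  shows "layer k \<alpha> = k + n - 1 \<longleftrightarrow> \<alpha> = Horiz k n"
  using assms by (cases \<alpha>) (auto simp: Vert_in_arcs Horiz_in_arcs)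

lemma finite_part: "finite (part k n l d q)"
  using finite_arcs[of k n] by (simp add: part_def)

lemma prod_split_ends:
  fixes g :: "nat \<Rightarrow> 'a :: comm_monoid_mult"
  shows "prod g {0..Suc l} = g 0 * (prod g {1..l} * g (Suc l))"
  by (simp add: prod.atLeast_Suc_atMost mult.assoc)

context
  fixes k n l :: nat and d :: "nat \<Rightarrow> nat"
  assumes kn: "1 \<le> k" "1 \<le> n" and fano: "(\<Sum>i = 1..l. d i) < k + n"
begin

lemma partial_deg_less: "q \<le> l \<Longrightarrow> partial_deg d q < k + n"
  using partial_deg_mono[of q l d] fano by (simp add: partial_deg_def)

lemma part_block: "p \<in> {1..l} \<Longrightarrow> part k n l d p = block k n d p"
  using block_layer[OF kn _ fano, of p] by (auto simp: part_def part_layers_def)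

lemma part_last: "part k n l d (Suc l) = {Horiz k n}"
proof -
  have "Horiz k n \<in> arcs (quiver k n)" by (simp add: Horiz_in_arcs)
  then show ?thesis
    using layer_eq_last_iff[OF kn] by (auto simp: part_def part_layers_def)
qed

lemma part_zero: "part k n l d 0 = block0 k n l d - {Horiz k n}"
proof (rule set_eqI)
  fix \<alpha>
  have "(\<exists>p\<in>{1..l}. partial_deg d (p - 1) \<le> t \<and> t < partial_deg d p) \<longleftrightarrow> t < partial_deg d l" for t
    using partial_deg_interval[of t d l] partial_deg_mono[of _ l d] by fastforce
  then have "\<alpha> \<in> (\<Union>p\<in>{1..l}. block k n d p) \<longleftrightarrow> layer k \<alpha> < partial_deg d l"
    if "\<alpha> \<in> arcs (quiver k n)"
    using that block_layer[OF kn _ fano] by auto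
  moreover have "\<alpha> = Horiz k n \<longleftrightarrow> \<not> layer k \<alpha> < k + n - 1" if "\<alpha> \<in> arcs (quiver k n)"
    using layer_less[OF kn that] layer_eq_last_iff[OF kn that] by auto
  ultimately show "\<alpha> \<in> part k n l d 0 \<longleftrightarrow> \<alpha> \<in> block0 k n l d - {Horiz k n}"
    by (auto simp: part_def part_layers_def block0_def)
qed

lemma UN_part: "(\<Union>q\<in>{0..Suc l}. part k n l d q) = arcs (quiver k n)"
proof
  show "arcs (quiver k n) \<subseteq> (\<Union>q\<in>{0..Suc l}. part k n l d q)"
  proof
    fix \<alpha> assume \<alpha>: "\<alpha> \<in> arcs (quiver k n)"
    have "part k n l d q \<subseteq> (\<Union>q\<in>{0..Suc l}. part k n l d q)" if "q \<le> Suc l" for q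
      using that by auto
    note sub = this[of 0, unfolded part_zero] this[of "Suc l", unfolded part_last]
    have "block k n d p \<subseteq> (\<Union>q\<in>{0..Suc l}. part k n l d q)" if "p \<in> {1..l}" for p
      using that UN_upper[of p "{0..Suc l}" "part k n l d"] by (simp add: part_block)
    then show "\<alpha> \<in> (\<Union>q\<in>{0..Suc l}. part k n l d q)"
      using \<alpha> sub unfolding block0_def by blast
  qed
qed (auto simp: part_def)

lemma disjoint_part: "disjoint_family_on (part k n l d) {0..Suc l}"
proof -
  have "part_layers k n l d p \<inter> part_layers k n l d q = {}" if "p < q" "q \<le> Suc l" for p q
  proof -
    have le: "partial_deg d p \<le> partial_deg d (q - 1)"
      using that by (intro partial_deg_mono) auto
    show ?thesis
    proof (cases "q \<le> l")
      case True
      then have "partial_deg d q \<le> partial_deg d l" by (rule partial_deg_mono)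
      then show ?thesis using that True le by (auto simp: part_layers_def)
    next
      case False
      then show ?thesis using that kn partial_deg_less[of p] by (auto simp: part_layers_def)
    qed
  qed
  then have "part k n l d p \<inter> part k n l d q = {}" if "p < q" "q \<le> Suc l" for p q
    using that unfolding part_def by blast
  then show ?thesis
    unfolding disjoint_family_on_def by (metis atLeastAtMost_iff inf_commute linorder_neqE_nat)
qed

lemma sum_part:
  assumes c: "c \<in> flows k n m" and q: "q \<le> Suc l"
  shows "sum c (part k n l d q) = card (part_layers k n l d q) * m"
proof -
  have "sum c (part k n l d q) = (\<Sum>u\<in>part_layers k n l d q. layer_sum k n c u)"
    unfolding part_def by (rule sum_over_layers) (simp add: part_layers_def)
  also have "\<dots> = (\<Sum>u\<in>part_layers k n l d q. m)"
  proof (rule sum.cong[OF refl])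
    fix u assume "u \<in> part_layers k n l d q"
    then have "u < k + n"
      using kn partial_deg_less[of q] by (auto simp: part_layers_def split: if_splits)
    then show "layer_sum k n c u = m" by (rule layer_sum_flow[OF kn c])
  qed
  finally show ?thesis by simp
qed

text \<open>
  The choices of arrows that contribute to the constant term are flows. The total over \<open>A\<close> has to be
  \<open>N - m\<close>, whereas a flow puts \<open>m\<close> units into each of the \<open>d\<^sub>0 - 1\<close> layers of \<open>A\<close>; hence
  only \<open>N = d\<^sub>0 m\<close> is possible.
\<close>

lemma balanced_choices_eq_flows:
  assumes pos: "\<And>i. i \<in> {1..l} \<Longrightarrow> d i \<ge> 1" and m: "m \<le> N"
  defines "e \<equiv> \<lambda>q. if q = 0 then N - m else if q \<le> l then d q * m else m"
  shows "{c. c \<in> multi_compositions {0..Suc l} (part k n l d) e \<and>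
           (\<forall>v. (\<Sum>\<alpha>\<in>arcs (quiver k n). int (c \<alpha>) *
              Poly_Mapping.lookup (drop_vars (weight_vars k l d) (arrow_exponent k n \<alpha>)) v) = 0)}
         = (if N = ext_deg k n l d 0 * m then flows k n m else {})"
    (is "{c. c \<in> ?M \<and> ?bal c} = ?R")
proof -
  let ?X = "weight_vars k l d" and ?E = "arrow_exponent k n"
  have card0: "card (part_layers k n l d 0) = ext_deg k n l d 0 - 1"
    by (simp add: part_layers_def ext_deg_def partial_deg_def)
  have d0: "ext_deg k n l d 0 \<ge> 1" using fano by (simp add: ext_deg_def)
  have N: "N - m = (ext_deg k n l d 0 - 1) * m \<longleftrightarrow> N = ext_deg k n l d 0 * m"
  proof -
    obtain r where "ext_deg k n l d 0 = Suc r" using d0 by (cases "ext_deg k n l d 0") auto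
    then show ?thesis using m by auto
  qed
  have M: "c \<in> ?M \<longleftrightarrow> on_quiver k n c \<and> (\<forall>q\<in>{0..Suc l}. sum c (part k n l d q) = e q)" for c
    by (simp add: multi_compositions_def UN_part on_quiver_def)
  have bal: "?bal c \<longleftrightarrow> (\<forall>v\<in>lg_vars k n - ?X. net_flow k n c v = 0)" if c: "on_quiver k n c" for c
  proof -
    have "(\<Sum>\<alpha>\<in>arcs (quiver k n). int (c \<alpha>) * Poly_Mapping.lookup (drop_vars ?X (?E \<alpha>)) v) =
          (if v \<in> lg_vars k n - ?X then net_flow k n c v else 0)" for v
    proof (cases "v \<in> lg_vars k n - ?X")
      case True
      then show ?thesis
        using lookup_arrow_exponents[OF kn c, of v] by (simp add: lookup_drop_vars)
    next
      case False
      then show ?thesis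
        using lookup_arrow_exponent_outside[OF kn, of _ v]
        by (auto simp: lookup_drop_vars intro!: sum.neutral)
    qed
    then show ?thesis by (simp add: Ball_def)
  qed
  have card_e: "card (part_layers k n l d q) * m = (if q = 0 then (ext_deg k n l d 0 - 1) * m else e q)"
    if q: "q \<le> Suc l" for q
  proof -
    consider "q = 0" | "q \<in> {1..l}" | "q = Suc l" using q by fastforce
    then show ?thesis
    proof cases
      case 2
      then show ?thesis
        using partial_deg_step[of q d] by (simp add: part_layers_def e_def)
    qed (simp_all only: card0, simp_all add: part_layers_def e_def)
  qed
  have "c \<in> ?M \<and> ?bal c \<longleftrightarrow> c \<in> ?R" for c
  proof
    assume c: "c \<in> ?M \<and> ?bal c"
    then have oq: "on_quiver k n c" and sums: "\<And>q. q \<le> Suc l \<Longrightarrow> sum c (part k n l d q) = e q"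
      by (auto simp: M)
    have h: "c (Horiz k n) = m"
      using sums[of "Suc l"] by (simp add: part_last e_def)
    have off: "net_flow k n c v = 0" if "v \<in> lg_vars k n" "v \<notin> ?X" for v
      using c that bal[OF oq] by simp
    have "net_flow k n c v = 0" if "v \<in> lg_vars k n" for v
    proof (cases "v \<in> ?X")
      case True
      then obtain p where p: "p \<in> {1..l}" "v = weight_var k d p"
        by (auto simp: weight_vars_def)
      have "sum c (block k n d p) = d p * c (Horiz k n)" if "p \<in> {1..l}" for p
        using sums[of p] that by (simp add: part_block h e_def)
      then show ?thesis
        unfolding p(2) by (intro net_flow_weight_var[OF kn pos fano oq off _ p(1)])
    qed (use off that in simp)
    then have flow: "c \<in> flows k n m"
      by (simp add: flows_def oq h)
    have "N - m = (ext_deg k n l d 0 - 1) * m"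
      using sums[of 0] sum_part[OF flow, of 0] card0 by (simp add: e_def)
    then show "c \<in> ?R" using flow N by simp
  next
    assume "c \<in> ?R"
    then have flow: "c \<in> flows k n m" and "N = ext_deg k n l d 0 * m"
      by (auto split: if_splits)
    then have N': "N - m = (ext_deg k n l d 0 - 1) * m" using N by blast
    have "sum c (part k n l d q) = e q" if "q \<le> Suc l" for q
      unfolding sum_part[OF flow that] card_e[OF that] using N' by (simp add: e_def)
    moreover have "on_quiver k n c" using flow by (simp add: flows_def)
    moreover have "\<forall>v\<in>lg_vars k n - ?X. net_flow k n c v = 0" using flow by (simp add: flows_def)
    ultimately show "c \<in> ?M \<and> ?bal c" using M bal by simp
  qed
  then show ?thesis by blast
qed

lemma subst_one_F: "subst_one X (F k n C) = (\<Sum>\<alpha>\<in>C. monomial (drop_vars X (arrow_exponent k n \<alpha>)))"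
  by (simp add: F_def subst_one_sum subst_one_monomial arrow_exponent_def quiver_def)

lemma monomial_ExtraVar_eq_F: "monomial (Poly_Mapping.single ExtraVar 1) = F k n {Horiz k n}"
  using kn by (simp add: F_def quiver_def vertex_exponent_def)

lemma constant_term_sum: "constant_term (sum f I) = (\<Sum>i\<in>I. constant_term (f i))"
  by (simp add: constant_term_def lookup_sum)

lemma constant_term_of_nat_mult: "constant_term (of_nat a * f) = of_nat a * constant_term f"
  by (induction a) (simp_all add: constant_term_def lookup_add algebra_simps)

text \<open>
  In the binomial expansion the multinomial factor \<open>(N - m)!\<close> of \<open>A\<close> combines with the binomial
  coefficient to \<open>N! / m!\<close>, and the factorial \<open>m!\<close> of the power of \<open>a\<close> cancels the denominator; with
  \<open>N = d\<^sub>0 m\<close> this supplies the factor \<open>(d\<^sub>0 m)!\<close>.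
\<close>

lemma constant_term_f_LG_power:
  assumes pos: "\<And>i. i \<in> {1..l} \<Longrightarrow> d i \<ge> 1"
  shows "constant_term (f_LG k n l d ^ N) =
     (if ext_deg k n l d 0 dvd N then I0_coeff k n l d (N div ext_deg k n l d 0) else 0)"
proof -
  let ?X = "weight_vars k l d" and ?d0 = "ext_deg k n l d 0"
  define G where "G q = (\<Sum>\<alpha>\<in>part k n l d q. monomial (drop_vars ?X (arrow_exponent k n \<alpha>)))" for q
  define e where "e = (\<lambda>m q. if q = 0 then N - m else if q \<le> l then d q * m else m)"
  define S :: "nat \<Rightarrow> complex" where
    "S m = (\<Sum>c\<in>flows k n m. 1 / (\<Prod>\<alpha>\<in>arcs (quiver k n). fact (c \<alpha>)))" for m
  have d0: "?d0 \<ge> 1" using fano by (simp add: ext_deg_def)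
  have G: "G 0 = subst_one ?X (F k n (block0 k n l d - {Horiz k n}))"
    "G (Suc l) = subst_one ?X (monomial (Poly_Mapping.single ExtraVar 1))"
    "\<And>p. p \<in> {1..l} \<Longrightarrow> G p = subst_one ?X (F k n (block k n d p))"
    by (simp_all only: G_def part_zero part_last part_block subst_one_F monomial_ExtraVar_eq_F)
  have "f_LG k n l d = G (Suc l) * (\<Prod>p = 1..l. G p ^ d p) + G 0"
    unfolding f_LG_def Let_def G(1,2)
    by (subst add.commute, intro arg_cong2[of _ _ _ _ "(+)"] arg_cong2[of _ _ _ _ "(*)"] prod.cong refl)
       (simp only: G(3))
  then have "f_LG k n l d ^ N =
      (\<Sum>m\<le>N. of_nat (N choose m) * (G (Suc l) * (\<Prod>p = 1..l. G p ^ d p)) ^ m * G 0 ^ (N - m))"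
    by (simp only: binomial_ring)
  also have "\<dots> = (\<Sum>m\<le>N. of_nat (N choose m) * (\<Prod>q\<in>{0..Suc l}. G q ^ e m q))"
  proof (rule sum.cong[OF refl])
    fix m
    have "(\<Prod>p = 1..l. G p ^ d p) ^ m = (\<Prod>p = 1..l. G p ^ e m p)"
      unfolding prod_power_distrib by (intro prod.cong) (auto simp: e_def power_mult)
    then show "of_nat (N choose m) * (G (Suc l) * (\<Prod>p = 1..l. G p ^ d p)) ^ m * G 0 ^ (N - m) =
               of_nat (N choose m) * (\<Prod>q\<in>{0..Suc l}. G q ^ e m q)"
      unfolding prod_split_ends by (simp add: power_mult_distrib e_def mult_ac)
  qed
  finally have "constant_term (f_LG k n l d ^ N) =
      (\<Sum>m\<le>N. of_nat (N choose m) * constant_term (\<Prod>q\<in>{0..Suc l}. G q ^ e m q))"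
    by (simp only: constant_term_sum constant_term_of_nat_mult)
  also have "\<dots> = (\<Sum>m\<le>N. if N = ?d0 * m then
                 of_nat (N choose m) * ((\<Prod>q\<in>{0..Suc l}. fact (e m q)) * S m) else 0)"
  proof (rule sum.cong[OF refl])
    fix m assume "m \<in> {..N}"
    then have m: "m \<le> N" by simp
    have "constant_term (\<Prod>q\<in>{0..Suc l}. G q ^ e m q) =
      (\<Sum>c\<in>(if N = ?d0 * m then flows k n m else {}).
         (\<Prod>q\<in>{0..Suc l}. fact (e m q)) / (\<Prod>\<alpha>\<in>arcs (quiver k n). fact (c \<alpha>)))"
      unfolding G_def
      by (subst constant_term_prod_power[OF _ finite_part disjoint_part])
         (simp_all only: UN_part balanced_choices_eq_flows[OF pos m] e_def finite_atLeastAtMost)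
    then show "of_nat (N choose m) * constant_term (\<Prod>q\<in>{0..Suc l}. G q ^ e m q) =
        (if N = ?d0 * m then of_nat (N choose m) * ((\<Prod>q\<in>{0..Suc l}. fact (e m q)) * S m) else 0)"
      by (simp add: S_def sum_distrib_left)
  qed
  also have "\<dots> = (if ?d0 dvd N then I0_coeff k n l d (N div ?d0) else 0)"
  proof (cases "?d0 dvd N")
    case False
    then show ?thesis by (auto intro!: sum.neutral)
  next
    case True
    then obtain M where M: "N = ?d0 * M" by blast
    then have "M \<le> N" using d0 by simp
    have "(\<Sum>m\<le>N. if N = ?d0 * m then
              of_nat (N choose m) * ((\<Prod>q\<in>{0..Suc l}. fact (e m q)) * S m) else 0) =
          (\<Sum>m\<le>N. if m = M then
              of_nat (N choose m) * ((\<Prod>q\<in>{0..Suc l}. fact (e m q)) * S m) else 0)"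
      using M d0 by (intro sum.cong) auto
    also have "\<dots> = of_nat (N choose M) * ((\<Prod>q\<in>{0..Suc l}. fact (e M q)) * S M)"
      using \<open>M \<le> N\<close> by simp
    also have "(\<Prod>q\<in>{0..Suc l}. fact (e M q)) = (fact (N - M) * ((\<Prod>p = 1..l. fact (d p * M)) * fact M) :: complex)"
      unfolding prod_split_ends by (simp add: e_def)
    also have "of_nat (N choose M) * (\<dots> * S M) = fact N * (\<Prod>p = 1..l. fact (d p * M)) * S M"
      using binomial_fact[OF \<open>M \<le> N\<close>, where 'a = complex] by simp
    also have "fact N * (\<Prod>p = 1..l. fact (d p * M)) =
               ((\<Prod>i = 0..l. fact (ext_deg k n l d i * M)) :: complex)"
      by (simp add: prod.atLeast_Suc_atMost M ext_deg_def)
    also have "\<dots> * S M = I0_coeff k n l d M"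
      by (simp add: I0_coeff_flows[OF kn] S_def)
    finally show ?thesis
      using True M d0 by simp
  qed
  finally show ?thesis .
qed

end

theorem proposition4:
  fixes k n l :: nat and d :: "nat \<Rightarrow> nat"
  assumes "k \<ge> 2" and "n \<ge> 2" and "l \<ge> 1"
    and "\<And>i. i \<in> {1..l} \<Longrightarrow> d i \<ge> 1"
    and "(\<Sum>i = 1..l. d i) < k + n"
  shows "period_series (f_LG k n l d) = I0_series k n l d"
proof -
  let ?q = "ext_deg k n l d 0"
  have "?q > 0" using assms(5) by (simp add: ext_deg_def)
  then have "I0_series k n l d =
      Abs_fps (\<lambda>i. if ?q dvd i then I0_coeff k n l d (i div ?q) else 0)"
    unfolding I0_series_def by (intro sums_unique[symmetric] fps_X_power_sums)
  moreover have "constant_term (f_LG k n l d ^ i) =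
      (if ?q dvd i then I0_coeff k n l d (i div ?q) else 0)" for i
    by (rule constant_term_f_LG_power) (use assms in auto)
  ultimately show ?thesis
    by (simp only: period_series_def)
qed

end
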